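(* For every $d\ge 1$ there is a bipartite graph $G_d$ with minimum degree $\delta(G_d)\ge 1$ and independence number $\alpha(G_d)=2^d-1$ such that $$f_o(G_d)\ \le\ \frac{\alpha(G_d)}{2}+\log_2\bigl(\alpha(G_d)+1\bigr)+\frac12.$$ Consequently, the additive term in the lower bound $$f_o(G)\ \ge\ \frac{\alpha(G)}{2}+\frac{\log_3(\alpha(G))}{8}-\frac{\log_3\log_3(\sqrt{\alpha(G)})}{4},$$ which holds for every graph $G$ with $\delta(G)\ge 1$ and $\alpha(G)\ge 2$, is of optimal order.
   Context: All graphs are finite and have no loops or multiple edges; $d$ is an integer. $f_o(G)$ denotes the maximum size of a set $S\subseteq V(G)$ such that every vertex of the induced subgraph $G[S]$ has odd degree in $G[S]$. $\delta(G)$ is the minimum degree of $G$, and $\alpha(G)$ is the maximum size of an independent set of $G$. The "additive term" is the part of the displayed lower bound added to $\alpha(G)/2$. *)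

theory Defs
  imports Complex_Main "HOL-Library.Landau_Symbols" "Graph_Theory.Graph_Theory"
begin

text \<open>
  A finite simple graph is a \<open>pair_graph\<close>: finite vertex set, and a symmetric irreflexive set of
  arcs. Each undirected edge is a pair of opposite arcs, so the degree of a vertex is its
  \<open>out_degree\<close>. The null graph is a \<open>pair_graph\<close> as well.
\<close>

definition bipartite :: "'a pair_pre_digraph \<Rightarrow> bool" where
  "bipartite G \<longleftrightarrow> (\<exists>X Y. pverts G = X \<union> Y \<and> X \<inter> Y = {} \<and> parcs G \<subseteq> X \<times> Y \<union> Y \<times> X)"

text \<open>Unspecified for the null graph, whose independence number is 0.\<close>

definition min_degree :: "'a pair_pre_digraph \<Rightarrow> nat" where
  "min_degree G = Min (out_degree (with_proj G) ` pverts G)"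

definition independent_vertices :: "'a pair_pre_digraph \<Rightarrow> 'a set \<Rightarrow> bool" where
  "independent_vertices G S \<longleftrightarrow> S \<subseteq> pverts G \<and> (\<forall>u\<in>S. \<forall>v\<in>S. (u, v) \<notin> parcs G)"

definition independence_number :: "'a pair_pre_digraph \<Rightarrow> nat" where
  "independence_number G = Max (card ` {S. independent_vertices G S})"

definition induces_odd_degrees :: "'a pair_pre_digraph \<Rightarrow> 'a set \<Rightarrow> bool" where
  "induces_odd_degrees G S \<longleftrightarrow>
     S \<subseteq> pverts G \<and> (\<forall>v\<in>S. odd (out_degree (with_proj G \<restriction> S) v))"

definition f_o :: "'a pair_pre_digraph \<Rightarrow> nat" where
  "f_o G = Max (card ` {S. induces_odd_degrees G S})"

definition additive_term :: "nat \<Rightarrow> real" where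
  "additive_term a = log 3 (real a) / 8 - log 3 (log 3 (sqrt (real a))) / 4"

text \<open>
  For \<open>a \<ge> 1\<close> this is the largest \<open>g a\<close> for which \<open>f_o G \<ge> a / 2 + g a\<close> holds for all graphs \<open>G\<close> of
  minimum degree at least 1 and independence number \<open>a\<close>: the infimum is over a nonempty
  set bounded below by \<open>- a / 2\<close>. Vertices are natural numbers without loss of
  generality, since all graphs are finite.
\<close>

definition best_additive_term :: "nat \<Rightarrow> real" where
  "best_additive_term a =
     (INF G \<in> {G :: nat pair_pre_digraph.
               pair_graph G \<and> min_degree G \<ge> 1 \<and> independence_number G = a}.
        real (f_o G) - real a / 2)"

end

theory Submission
  imports Defs "HOL-Real_Asymp.Real_Asymp"
begin

text \<open>
  Lower bound. Let \<open>I\<close> be a maximum independent set of size \<open>a\<close> and \<open>W\<close> a minimal set of \<open>k\<close>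
  vertices outside \<open>I\<close> dominating \<open>I\<close>; each \<open>w \<in> W\<close> has a private neighbour in \<open>I\<close>. For
  \<open>T \<subseteq> W\<close>, take \<open>T\<close> together with the vertices of \<open>I\<close> that have odd degree into \<open>T\<close>, and delete
  the private neighbour of each \<open>w \<in> T\<close> of even degree. The resulting set has size at least the
  number of odd vertices in \<open>I\<close>, plus one for each \<open>w \<in> T\<close> that needed no deletion. Averaging over
  the nonempty \<open>T\<close> gives \<open>f_o \<ge> (a / 2) * 2 ^ k / (2 ^ k - 1)\<close>. Since the degree of \<open>w\<close> is
  linear in \<open>T\<close> modulo 2, averaging also gains \<open>1 / 4\<close> for each \<open>w\<close> for which this linear form is
  nonzero. The other (bad) vertices of \<open>W\<close> are made good by discarding vertices of \<open>I\<close> with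
  at least three bad neighbours; once every vertex has at most two, \<open>T\<close> is chosen on the bad
  vertices by a max-cut argument, which again gains \<open>1 / 4\<close> per vertex. Altogether
  \<open>f_o \<ge> a / 2 + k / 12\<close>, and one of the two bounds always suffices.

  Upper bound. Join \<open>i < d\<close> to the nonempty subsets of \<open>{..<d}\<close> containing \<open>i\<close>: any \<open>T \<subseteq> {..<d}\<close>
  meets at most \<open>2 ^ (d - 1)\<close> of these subsets in an odd number of elements. For the values of
  \<open>a\<close> not of the form \<open>2 ^ d - 1\<close>, write \<open>a\<close> as a sum of logarithmically many such numbers and
  use the subsets of nested cubes on the same \<open>d\<close> vertices.
\<close>

section \<open>Parity counts\<close>

text \<open>The parity arguments work with a bare relation;
  \<open>out_degree_induce_subgraph\<close> and \<open>out_degree_with_proj\<close> translate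
  degrees into this form.\<close>

definition nbrs :: "'a rel \<Rightarrow> 'a \<Rightarrow> 'a set \<Rightarrow> 'a set" where
  "nbrs E v S = {u \<in> S. (v, u) \<in> E}"

lemma finite_nbrs [simp]: "finite S \<Longrightarrow> finite (nbrs E v S)"
  by (simp add: nbrs_def)

lemma nbrs_insert:
  "nbrs E v (insert u S) = (if (v, u) \<in> E then insert u (nbrs E v S) else nbrs E v S)"
  by (auto simp: nbrs_def)

lemma even_card_Diff_subset:
  assumes "finite A" "B \<subseteq> A"
  shows "even (card (A - B)) \<longleftrightarrow> (even (card A) \<longleftrightarrow> even (card B))"
proof -
  have "card A = card (A - B) + card B"
    using assms by (metis add.commute card_Un_disjoint Diff_disjoint Un_Diff_cancel finite_Diff
        finite_subset sup.absorb2)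
  then show ?thesis by auto
qed

text \<open>Adding or removing \<open>u\<close> pairs the subsets satisfying \<open>Q\<close> with
  those that do not.\<close>

lemma card_toggle:
  assumes fin: "finite C" and u: "u \<in> C"
    and toggle: "\<And>X. X \<subseteq> C - {u} \<Longrightarrow> Q (insert u X) \<longleftrightarrow> \<not> Q X"
  shows "2 * card {X. X \<subseteq> C \<and> Q X} = 2 ^ card C"
proof -
  let ?D = "C - {u}"
  have split: "{X. X \<subseteq> C \<and> Q X} = {X \<in> Pow ?D. Q X} \<union> insert u ` {X \<in> Pow ?D. \<not> Q X}"
    (is "?L = ?A \<union> ?B")
  proof
    show "?L \<subseteq> ?A \<union> ?B"
    proof
      fix X assume X: "X \<in> ?L"
      show "X \<in> ?A \<union> ?B"
      proof (cases "u \<in> X")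
        case True
        then have "X = insert u (X - {u})" by auto
        moreover have "X - {u} \<in> Pow ?D" using X by auto
        ultimately show ?thesis using X toggle[of "X - {u}"] by (metis (mono_tags, lifting)
              Pow_iff UnI2 imageI mem_Collect_eq)
      next
        case False
        then show ?thesis using X by auto
      qed
    qed
    show "?A \<union> ?B \<subseteq> ?L" using u toggle by auto
  qed
  have "inj_on (insert u) {X \<in> Pow ?D. \<not> Q X}"
    by (rule inj_onI) (auto simp: insert_ident)
  moreover have "?A \<inter> ?B = {}" by auto
  moreover have "finite (Pow ?D)" using fin by simp
  ultimately have "card ?L = card ?A + card {X \<in> Pow ?D. \<not> Q X}"
    unfolding split by (subst card_Un_disjoint) (auto simp: card_image)
  also have "\<dots> = card (?A \<union> {X \<in> Pow ?D. \<not> Q X})"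
    using \<open>finite (Pow ?D)\<close> by (subst card_Un_disjoint) auto
  also have "?A \<union> {X \<in> Pow ?D. \<not> Q X} = Pow ?D" by auto
  also have "card \<dots> = 2 ^ (card C - 1)" using fin u by (simp add: card_Pow)
  finally have "card ?L = 2 ^ (card C - 1)" .
  moreover have "card C > 0" using fin u by (auto simp: card_gt_0_iff)
  ultimately show ?thesis by (cases "card C") auto
qed

lemma sum_card_swap:
  assumes "finite A" "finite B"
  shows "(\<Sum>x\<in>A. card {y \<in> B. P x y}) = (\<Sum>y\<in>B. card {x \<in> A. P x y})"
proof -
  have "(\<Sum>x\<in>A. card {y \<in> B. P x y}) = (\<Sum>x\<in>A. \<Sum>y\<in>B. of_bool (P x y))"
    using assms by (intro sum.cong) (auto simp: Int_def)
  also have "\<dots> = (\<Sum>y\<in>B. \<Sum>x\<in>A. of_bool (P x y))" by (rule sum.swap)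
  also have "\<dots> = (\<Sum>y\<in>B. card {x \<in> A. P x y})"
    using assms by (intro sum.cong) (auto simp: Int_def)
  finally show ?thesis .
qed

text \<open>Max-cut, with each \<open>N v\<close> read as an edge or a loop of a multigraph on
  \<open>B\<close>. The induction takes an edge \<open>{u, w}\<close> and puts exactly one end into
  \<open>Y\<close>, whichever serves the sets containing just one end better.\<close>

lemma odd_cut:
  fixes N :: "'v \<Rightarrow> 'w set"
  assumes "finite J" "finite B"
    and "\<And>v. v \<in> J \<Longrightarrow> N v \<subseteq> B \<and> N v \<noteq> {} \<and> card (N v) \<le> 2"
    and "\<And>w. w \<in> B \<Longrightarrow> \<exists>v\<in>J. N v = {w}"
  shows "\<exists>Y\<subseteq>B. 2 * card J + card B \<le> 4 * card {v \<in> J. odd (card (N v \<inter> Y))}"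
  using assms
proof (induction "card B" arbitrary: B J rule: less_induct)
  case less
  note finJ = less.prems(1) and finB = less.prems(2) and N = less.prems(3) and priv = less.prems(4)
  show ?case
  proof (cases "\<exists>v\<in>J. card (N v) = 2")
    \<comment> \<open>Only singletons remain: \<open>Y = B\<close> makes all of \<open>J\<close>
      odd, and the private singletons give \<open>card B \<le> card J\<close>.\<close>
    case False
    have one: "card (N v) = 1" if "v \<in> J" for v
    proof -
      have "card (N v) \<noteq> 0" using N[OF that] finB finite_subset by fastforce
      then show ?thesis using N[OF that] False that
        by (metis One_nat_def Suc_1 le_SucE le_zero_eq)
    qed
    have "{v \<in> J. odd (card (N v \<inter> B))} = J"
      using one N by (auto simp: Int_absorb2)
    moreover have "card B \<le> card J"
    proof -
      obtain f where f: "\<And>w. w \<in> B \<Longrightarrow> f w \<in> J \<and> N (f w) = {w}" using priv by metis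
      then have "inj_on f B" by (metis inj_onI singleton_inject)
      then show ?thesis using f finJ by (intro card_inj_on_le[of f]) auto
    qed
    ultimately show ?thesis by (intro exI[of _ B]) auto
  next
    case True
    then obtain z u w where z: "z \<in> J" "N z = {u, w}" "u \<noteq> w" by (auto simp: card_2_iff)
    define B' where "B' = B - {u, w}"
    define J' where "J' = {v \<in> J. N v \<inter> {u, w} = {}}"
    define J1 where "J1 = {v \<in> J. card (N v \<inter> {u, w}) = 1}"
    define J2 where "J2 = {v \<in> J. N v = {u, w}}"
    have uw: "u \<in> B" "w \<in> B" using N[OF z(1)] z by auto
    have cB: "card B = card B' + 2"
      using uw z finB card_mono[of B "{u,w}"] by (simp add: B'_def card_Diff_subset)
    have part: "v \<in> J' \<or> v \<in> J1 \<or> v \<in> J2" if "v \<in> J" for v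
    proof -
      have "finite (N v)" using N[OF that] finB finite_subset by blast
      moreover have "{u, w} = N v" if "u \<in> N v" "w \<in> N v"
        using that \<open>v \<in> J\<close> N[of v] z(3) \<open>finite (N v)\<close> by (intro card_seteq) auto
      ultimately show ?thesis
        using that by (cases "u \<in> N v"; cases "w \<in> N v") (auto simp: J'_def J1_def J2_def)
    qed
    have fin: "finite J'" "finite J1" "finite J2" using finJ by (auto simp: J'_def J1_def J2_def)
    have disj: "J' \<inter> J1 = {}" "J' \<inter> J2 = {}" "J1 \<inter> J2 = {}"
      using z by (auto simp: J'_def J1_def J2_def)
    have "J = J' \<union> J1 \<union> J2" using part by (auto simp: J'_def J1_def J2_def)
    then have cJ: "card J = card J' + card J1 + card J2"
      using fin disj by (simp add: card_Un_disjoint Int_Un_distrib2)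
    have "z \<in> J2" using z by (simp add: J2_def)
    then have J2: "card J2 \<ge> 1" using fin by (metis One_nat_def Suc_leI card_gt_0_iff empty_iff)
    have "\<exists>Y\<subseteq>B'. 2 * card J' + card B' \<le> 4 * card {v \<in> J'. odd (card (N v \<inter> Y))}"
    proof (rule less.hyps)
      show "card B' < card B" using cB by simp
      show "finite J'" "finite B'" using fin finB by (auto simp: B'_def)
      show "N v \<subseteq> B' \<and> N v \<noteq> {} \<and> card (N v) \<le> 2" if "v \<in> J'" for v
        using that N[of v] by (auto simp: J'_def B'_def)
      show "\<exists>v\<in>J'. N v = {x}" if "x \<in> B'" for x
        using that priv[of x] by (fastforce simp: J'_def B'_def)
    qed
    then obtain Y where Y: "Y \<subseteq> B'"
      and IH: "2 * card J' + card B' \<le> 4 * card {v \<in> J'. odd (card (N v \<inter> Y))}" by blast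
    define F where "F X = {v \<in> J. odd (card (N v \<inter> X))}" for X
    have uwY: "u \<notin> Y" "w \<notin> Y" using Y by (auto simp: B'_def)
    have finN: "finite (N v)" if "v \<in> J" for v using N[OF that] finB finite_subset by blast
    \<comment> \<open>Whichever end is added, \<open>J'\<close> keeps the parities given by
      \<open>Y\<close> and all of \<open>J2\<close> becomes odd; only \<open>J1\<close> depends on
      the choice.\<close>
    have card_F: "card (F (insert t Y)) =
        card {v \<in> J'. odd (card (N v \<inter> Y))} + card (F (insert t Y) \<inter> J1) + card J2"
      if t: "t = u \<or> t = w" for t
    proof -
      have a: "F (insert t Y) \<inter> J' = {v \<in> J'. odd (card (N v \<inter> Y))}"
        using t by (auto simp: F_def J'_def)
      have "N v \<inter> insert t Y = {t}" if "v \<in> J2" for v using that t uwY by (auto simp: J2_def)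
      then have b: "F (insert t Y) \<inter> J2 = J2" by (auto simp: F_def J2_def)
      have "F (insert t Y) = (F (insert t Y) \<inter> J') \<union> (F (insert t Y) \<inter> J1) \<union> (F (insert t Y) \<inter> J2)"
        using \<open>J = J' \<union> J1 \<union> J2\<close> by (auto simp: F_def)
      also have "card \<dots> = card (F (insert t Y) \<inter> J') + card (F (insert t Y) \<inter> J1) +
          card (F (insert t Y) \<inter> J2)"
        using fin disj by (subst card_Un_disjoint; (auto)?; subst card_Un_disjoint; auto)
      finally show ?thesis by (simp only: a b)
    qed
    have "J1 \<subseteq> (F (insert u Y) \<inter> J1) \<union> (F (insert w Y) \<inter> J1)"
    proof
      fix v assume v: "v \<in> J1"
      then have "v \<in> J" by (simp add: J1_def)
      from v have "(u \<in> N v \<and> w \<notin> N v) \<or> (w \<in> N v \<and> u \<notin> N v)"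
        using z(3) by (cases "u \<in> N v"; cases "w \<in> N v") (auto simp: J1_def)
      then have "odd (card (N v \<inter> insert u Y)) \<or> odd (card (N v \<inter> insert w Y))"
        using uwY finN[OF \<open>v \<in> J\<close>] by (auto simp: Int_insert_right)
      then show "v \<in> (F (insert u Y) \<inter> J1) \<union> (F (insert w Y) \<inter> J1)"
        using v \<open>v \<in> J\<close> by (auto simp: F_def)
    qed
    then have "card J1 \<le> card ((F (insert u Y) \<inter> J1) \<union> (F (insert w Y) \<inter> J1))"
      using fin by (intro card_mono) auto
    also have "\<dots> \<le> card (F (insert u Y) \<inter> J1) + card (F (insert w Y) \<inter> J1)" by (rule card_Un_le)
    finally have "\<exists>t\<in>{u, w}. card J1 \<le> 2 * card (F (insert t Y) \<inter> J1)" by auto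
    then obtain t where t: "t \<in> {u, w}" "card J1 \<le> 2 * card (F (insert t Y) \<inter> J1)" by blast
    \<comment> \<open>All of \<open>J2\<close> is odd although only half is asked for; the surplus
      \<open>2 * card J2 \<ge> 2\<close> pays for \<open>u\<close> and \<open>w\<close> in
      \<open>card B\<close>.\<close>
    have "2 * card J + card B \<le> 4 * card (F (insert t Y))"
      using card_F[of t] t IH cJ cB J2 by auto
    moreover have "insert t Y \<subseteq> B" using t uw Y by (auto simp: B'_def)
    ultimately show ?thesis unfolding F_def by blast
  qed
qed

section \<open>Dominating sets with private neighbours\<close>

lemma ex_ge_average:
  fixes f :: "'b \<Rightarrow> nat"
  assumes "finite A" "A \<noteq> {}" "card A * m \<le> sum f A"
  shows "\<exists>x\<in>A. m \<le> f x"
proof (rule ccontr)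
  assume "\<not> ?thesis"
  then have "sum f A < (\<Sum>x\<in>A. m)" using assms by (intro sum_strict_mono) auto
  with assms show False by simp
qed

text \<open>Minimality of the dominating set \<open>W\<close> is recorded through the private
  neighbours \<open>p w\<close>. Edges inside \<open>W\<close> are allowed.\<close>

locale private_domination =
  fixes E :: "'a rel" and I W :: "'a set" and p :: "'a \<Rightarrow> 'a"
  assumes finite_I: "finite I" and finite_W: "finite W"
    and E_sym: "(u, v) \<in> E \<Longrightarrow> (v, u) \<in> E"
    and E_irrefl: "(u, u) \<notin> E"
    and indep: "u \<in> I \<Longrightarrow> v \<in> I \<Longrightarrow> (u, v) \<notin> E"
    and disjoint: "I \<inter> W = {}"
    and dominated: "v \<in> I \<Longrightarrow> \<exists>w\<in>W. (v, w) \<in> E"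
    and p_in_I: "w \<in> W \<Longrightarrow> p w \<in> I"
    and p_private: "w \<in> W \<Longrightarrow> u \<in> W \<Longrightarrow> (p w, u) \<in> E \<longleftrightarrow> u = w"
begin

definition odds :: "'a set \<Rightarrow> 'a set \<Rightarrow> 'a set" where
  "odds J T = {v \<in> J. odd (card (nbrs E v T))}"

text \<open>These vertices need no deletion in \<open>ex_odd_set\<close>; each is a gain of
  one.\<close>

definition right :: "'a set \<Rightarrow> 'a set \<Rightarrow> 'a set" where
  "right J T = {w \<in> T. odd (card (nbrs E w (T \<union> odds J T)))}"

text \<open>Modulo 2, the coefficient of \<open>u\<close> in the linear form giving the degree of
  \<open>w\<close>: the edge between them and the walks of length two through
  \<open>J\<close>.\<close>

definition links :: "'a set \<Rightarrow> 'a \<Rightarrow> 'a \<Rightarrow> nat" where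
  "links J u w = of_bool ((u, w) \<in> E) + card {v \<in> J. (v, u) \<in> E \<and> (v, w) \<in> E}"

text \<open>The linear form of such a vertex vanishes modulo 2; by \<open>links_sym\<close> the
  vertex does not influence the forms of the others either.\<close>

definition bad :: "'a set \<Rightarrow> 'a set" where
  "bad J = {w \<in> W. \<forall>u\<in>W. even (links J u w)}"

lemma inj_p: "inj_on p W"
  using p_private by (metis inj_onI)

lemma finite_J: "J \<subseteq> I \<Longrightarrow> finite J"
  using finite_I finite_subset by blast

lemma finite_T: "T \<subseteq> W \<Longrightarrow> finite T"
  using finite_W finite_subset by blast

lemma E_sym_iff: "(u, v) \<in> E \<longleftrightarrow> (v, u) \<in> E"
  using E_sym by blast

lemma links_sym: "links J u w = links J w u"
  using E_sym_iff[of u w] by (simp add: links_def conj_commute)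

lemma bad_subset: "bad J \<subseteq> W"
  by (auto simp: bad_def)

text \<open>
  Removing the private neighbour of \<open>w\<close> changes the parity of the degree of \<open>w\<close> and of no
  other vertex of \<open>T\<close>.
\<close>

lemma ex_odd_set:
  assumes T: "T \<subseteq> W" and J: "J \<subseteq> I" "p ` W \<subseteq> J"
  shows "\<exists>S\<subseteq>I \<union> W. (\<forall>v\<in>S. odd (card (nbrs E v S))) \<and>
           card S = card (odds J T) + card (right J T)"
proof -
  define D where "D = p ` (T - right J T)"
  define S where "S = T \<union> (odds J T - D)"
  have finT: "finite T" and finO: "finite (odds J T)"
    using finite_T[OF T] finite_J[OF J(1)] by (auto simp: odds_def)
  have p_odd: "p w \<in> odds J T" if "w \<in> T" for w
  proof -
    have "nbrs E (p w) T = {w}" using that T p_private by (auto simp: nbrs_def)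
    moreover have "p w \<in> J" using that T J by blast
    ultimately show ?thesis by (simp add: odds_def)
  qed
  have OI: "odds J T \<subseteq> I" using J by (auto simp: odds_def)
  have "D \<subseteq> odds J T" using p_odd by (auto simp: D_def)
  have "odd (card (nbrs E v S))" if "v \<in> S" for v
  proof (cases "v \<in> T")
    case False
    then have v: "v \<in> odds J T" using that by (auto simp: S_def)
    then have "nbrs E v S = nbrs E v T"
      using OI indep by (auto simp: nbrs_def S_def)
    then show ?thesis using v by (simp add: odds_def)
  next
    case True
    then have vW: "v \<in> W" using T by auto
    have pT: "p w \<notin> T" if "w \<in> T" for w using that T p_in_I disjoint by blast
    have adj: "(v, p w) \<in> E \<longleftrightarrow> w = v" if "w \<in> T" for w
      using that p_private[of w v] vW T E_sym_iff by auto
    show ?thesis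
    proof (cases "v \<in> right J T")
      case True
      have "nbrs E v S = nbrs E v (T \<union> odds J T)"
        using adj True by (auto simp: nbrs_def S_def D_def)
      then show ?thesis using True by (simp add: right_def)
    next
      case False
      have "nbrs E v S = nbrs E v (T \<union> odds J T) - {p v}"
        using adj False \<open>v \<in> T\<close> pT p_odd by (auto simp: nbrs_def S_def D_def)
      moreover have "p v \<in> nbrs E v (T \<union> odds J T)"
        using adj \<open>v \<in> T\<close> p_odd by (auto simp: nbrs_def)
      moreover have "even (card (nbrs E v (T \<union> odds J T)))"
        using False \<open>v \<in> T\<close> by (auto simp: right_def)
      ultimately show ?thesis
        using finT finO by (subst \<open>nbrs E v S = _\<close>, subst even_card_Diff_subset) auto
    qed
  qed
  moreover have "S \<subseteq> I \<union> W" using T OI by (auto simp: S_def)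
  \<comment> \<open>\<open>T\<close> adds \<open>card T\<close> vertices and \<open>D\<close>
    removes one for each vertex of \<open>T - right J T\<close>; the balance is
    \<open>card (right J T)\<close>.\<close>
  moreover have "card S = card (odds J T) + card (right J T)"
  proof -
    have "card S = card T + card (odds J T - D)"
      unfolding S_def using finT finO OI T disjoint by (intro card_Un_disjoint) auto
    also have "card (odds J T - D) = card (odds J T) - card D"
      using \<open>D \<subseteq> odds J T\<close> finO by (intro card_Diff_subset) (auto dest: finite_subset)
    also have "card D = card (T - right J T)"
      unfolding D_def using T by (intro card_image inj_on_subset[OF inj_p]) auto
    also have "\<dots> = card T - card (right J T)"
      using finT by (intro card_Diff_subset) (auto simp: right_def)
    finally show ?thesis
      using card_mono[OF finO \<open>D \<subseteq> odds J T\<close>] \<open>card D = _\<close> \<open>card (T - _) = _\<close>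
        card_mono[OF finT, of "right J T"] by (auto simp: right_def)
  qed
  ultimately show ?thesis by blast
qed

text \<open>Modulo 2, membership of \<open>v\<close> in \<open>odds J T\<close> equals the degree of
  \<open>v\<close> into \<open>T\<close>, so neighbours of \<open>w\<close> in
  \<open>odds J T\<close> become walks from \<open>w\<close> through \<open>J\<close> to
  \<open>T\<close>. Exchanging the sums groups them by their end \<open>u\<close>.\<close>

lemma odd_degree_iff:
  assumes T: "T \<subseteq> W" and J: "J \<subseteq> I"
  shows "odd (card (nbrs E w (T \<union> odds J T))) \<longleftrightarrow> odd (\<Sum>u\<in>T. links J u w)"
proof -
  let ?J = "{v \<in> J. (v, w) \<in> E}"
  have finT: "finite T" and finJ: "finite J" using finite_T[OF T] finite_J[OF J] .
  have "nbrs E w (T \<union> odds J T) = nbrs E w T \<union> {v \<in> ?J. odd (card (nbrs E v T))}"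
    using E_sym_iff by (auto simp: nbrs_def odds_def)
  also have "card \<dots> = card (nbrs E w T) + card {v \<in> ?J. odd (card (nbrs E v T))}"
    using finT finJ T J disjoint by (intro card_Un_disjoint) (auto simp: nbrs_def)
  also have "even \<dots> \<longleftrightarrow> even (card (nbrs E w T) + (\<Sum>v\<in>?J. card (nbrs E v T)))"
    using finJ by (simp add: even_sum_iff)
  also have "card (nbrs E w T) = (\<Sum>u\<in>T. of_bool ((u, w) \<in> E))"
    using finT E_sym_iff[of w] by (simp add: nbrs_def Int_def)
  also have "(\<Sum>v\<in>?J. card (nbrs E v T)) = (\<Sum>u\<in>T. card {v \<in> ?J. (v, u) \<in> E})"
    unfolding nbrs_def using finT finJ by (intro sum_card_swap) auto
  also have "(\<Sum>u\<in>T. of_bool ((u, w) \<in> E)) + \<dots> = (\<Sum>u\<in>T. links J u w)"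
    unfolding links_def sum.distrib[symmetric]
    by (intro sum.cong refl arg_cong2[of _ _ _ _ "(+)"] arg_cong[of _ _ card]) auto
  finally show ?thesis by simp
qed

text \<open>
  A vertex with at least three bad neighbours makes each of them good when it leaves \<open>J\<close>, which
  is worth the vertex.
\<close>

lemma ex_drop:
  "\<exists>R\<subseteq>I - p ` W. 3 * card R + card (bad (I - R)) \<le> card W \<and>
     (\<forall>v\<in>I - R. card (nbrs E v (bad (I - R))) \<le> 2)"
proof -
  define \<R> where "\<R> = {R. R \<subseteq> I - p ` W \<and> 3 * card R + card (bad (I - R)) \<le> card W}"
  have "finite \<R>" by (rule finite_subset[of _ "Pow I"]) (use finite_I in \<open>auto simp: \<R>_def\<close>)
  moreover have "{} \<in> \<R>" using card_mono[OF finite_W bad_subset] by (auto simp: \<R>_def)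
  \<comment> \<open>By maximality of \<open>R\<close>, a vertex left with three bad neighbours leads
    to a contradiction: it could be added.\<close>
  ultimately obtain R where R: "R \<in> \<R>" and max: "\<And>R'. R' \<in> \<R> \<Longrightarrow> R \<subseteq> R' \<Longrightarrow> R' = R"
    using finite_has_maximal2[of \<R> "{}"] by metis
  have "card (nbrs E v (bad (I - R))) \<le> 2" if v: "v \<in> I - R" for v
  proof (rule ccontr)
    let ?B = "bad (I - R)" and ?B' = "bad (I - insert v R)"
    assume "\<not> ?thesis"
    then have three: "card (nbrs E v ?B) \<ge> 3" by simp
    have finB: "finite ?B" using finite_T[OF bad_subset] .
    have "v \<notin> p ` W"
    proof
      assume "v \<in> p ` W"
      then obtain w where w: "w \<in> W" "v = p w" by auto
      then have "nbrs E v ?B \<subseteq> {w}" using p_private bad_subset by (auto simp: nbrs_def)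
      then have "card (nbrs E v ?B) \<le> card {w}" by (intro card_mono) auto
      with three show False by simp
    qed
    have step: "links (I - R) u w = links (I - insert v R) u w + of_bool ((v, u) \<in> E \<and> (v, w) \<in> E)"
      for u w
    proof -
      have "{x \<in> I - R. (x, u) \<in> E \<and> (x, w) \<in> E} =
          {x \<in> I - insert v R. (x, u) \<in> E \<and> (x, w) \<in> E} \<union> (if (v, u) \<in> E \<and> (v, w) \<in> E then {v} else {})"
        using v by (auto split: if_splits)
      also have "card \<dots> = card {x \<in> I - insert v R. (x, u) \<in> E \<and> (x, w) \<in> E} +
          card (if (v, u) \<in> E \<and> (v, w) \<in> E then {v} else {})"
        using finite_I by (intro card_Un_disjoint) auto
      finally show ?thesis by (simp add: links_def)
    qed
    \<comment> \<open>For a neighbour \<open>w\<close> and a bad neighbour \<open>u\<close> of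
      \<open>v\<close>, dropping \<open>v\<close> makes the even number
      \<open>links (I - R) u w\<close> odd, so \<open>w\<close> is good afterwards. Non-neighbours
      of \<open>v\<close> keep all their links, so none turns bad.\<close>
    have "?B' \<subseteq> ?B - nbrs E v ?B"
    proof
      fix w assume w: "w \<in> ?B'"
      have nadj: "(v, w) \<notin> E"
      proof
        assume vw: "(v, w) \<in> E"
        have "nbrs E v ?B \<noteq> {}" using three by auto
        then obtain u where u: "u \<in> ?B" "(v, u) \<in> E" by (auto simp: nbrs_def)
        then have "even (links (I - R) u w)"
          using links_sym w bad_subset by (auto simp: bad_def)
        moreover have "even (links (I - insert v R) u w)"
          using u w bad_subset by (auto simp: bad_def)
        ultimately show False using step[of u w] u vw by simp
      qed
      then have "w \<in> ?B" using w step[of _ w] by (auto simp: bad_def)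
      with nadj show "w \<in> ?B - nbrs E v ?B" by (auto simp: nbrs_def)
    qed
    then have "card ?B' \<le> card (?B - nbrs E v ?B)" using finB by (intro card_mono) auto
    also have "\<dots> = card ?B - card (nbrs E v ?B)"
      using finB by (intro card_Diff_subset) (auto simp: nbrs_def)
    finally have "card ?B' + 3 \<le> card ?B"
      using three card_mono[OF finB, of "nbrs E v ?B"] by (auto simp: nbrs_def)
    moreover have "finite R" using R finite_I by (auto simp: \<R>_def dest: finite_subset)
    ultimately have "insert v R \<in> \<R>"
      using R v \<open>v \<notin> p ` W\<close> by (auto simp: \<R>_def)
    then show False using max[of "insert v R"] v by auto
  qed
  with R show ?thesis by (auto simp: \<R>_def)
qed

text \<open>A good \<open>w\<close> lies in half of all \<open>X\<close>, and its linear form is odd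
  for at least half of those, hence the factor 4. Bad vertices in \<open>Y\<close> contribute even
  terms.\<close>

lemma card_right_toggle:
  assumes J: "J \<subseteq> I" and Y: "Y \<subseteq> bad J" and w: "w \<in> W - bad J"
  shows "2 ^ card (W - bad J) \<le> 4 * card {X. X \<subseteq> W - bad J \<and> w \<in> right J (X \<union> Y)}"
proof -
  let ?C = "W - bad J"
  define Q where "Q X \<longleftrightarrow> odd (\<Sum>u\<in>insert w X. links J u w)" for X
  have finC: "finite ?C" using finite_W by simp
  have Q: "w \<in> right J (insert w X \<union> Y) \<longleftrightarrow> Q X" if X: "X \<subseteq> ?C - {w}" for X
  proof -
    have fin: "finite X" "finite Y" using X Y bad_subset finite_W by (meson Diff_subset finite_T
          order_trans)+
    have "insert w X \<union> Y \<subseteq> W" using X Y w bad_subset by auto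
    then have "w \<in> right J (insert w X \<union> Y) \<longleftrightarrow> odd (\<Sum>u\<in>insert w X \<union> Y. links J u w)"
      using odd_degree_iff[OF _ J, of "insert w X \<union> Y" w] by (simp add: right_def)
    also have "(\<Sum>u\<in>insert w X \<union> Y. links J u w) =
        (\<Sum>u\<in>insert w X. links J u w) + (\<Sum>u\<in>Y. links J u w)"
      using fin X Y w by (intro sum.union_disjoint) auto
    also have "odd \<dots> \<longleftrightarrow> Q X"
    proof -
      have "even (links J u w)" if "u \<in> Y" for u
        using that Y w links_sym[of J u w] by (auto simp: bad_def)
      then have "even (\<Sum>u\<in>Y. links J u w)" by (simp add: dvd_sum)
      then show ?thesis by (simp add: Q_def)
    qed
    finally show ?thesis .
  qed
  have "{X. X \<subseteq> ?C \<and> w \<in> right J (X \<union> Y)} = insert w ` {X. X \<subseteq> ?C - {w} \<and> Q X}"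
    (is "?L = ?R")
  proof
    show "?L \<subseteq> ?R"
    proof
      fix X assume X: "X \<in> ?L"
      then have "w \<in> X" using Y w by (auto simp: right_def)
      then have "X = insert w (X - {w})" by auto
      moreover from this have "X - {w} \<in> {X. X \<subseteq> ?C - {w} \<and> Q X}"
        using X Q[of "X - {w}"] by auto
      ultimately show "X \<in> ?R" by blast
    qed
    show "?R \<subseteq> ?L"
    proof
      fix Z assume "Z \<in> ?R"
      then obtain X where X: "Z = insert w X" "X \<subseteq> ?C - {w}" "Q X" by blast
      then show "Z \<in> ?L" using Q[OF X(2)] w by blast
    qed
  qed
  moreover have "inj_on (insert w) {X. X \<subseteq> ?C - {w} \<and> Q X}"
    by (rule inj_onI) (auto simp: insert_ident)
  ultimately have cL: "card ?L = card {X. X \<subseteq> ?C - {w} \<and> Q X}" by (simp add: card_image)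
  have cC: "card ?C = Suc (card (?C - {w}))" using finC w by (metis card_Suc_Diff1)
  have "2 ^ card (?C - {w}) \<le> 2 * card {X. X \<subseteq> ?C - {w} \<and> Q X}"
  \<comment> \<open>Either another good vertex has an odd coefficient and toggles the form, or the
    only odd coefficient is that of \<open>w\<close> itself and the form is constantly odd.\<close>
  proof (cases "\<exists>u\<in>?C - {w}. odd (links J u w)")
    case True
    then obtain u where u: "u \<in> ?C - {w}" "odd (links J u w)" by blast
    have "Q (insert u X) \<longleftrightarrow> \<not> Q X" if "X \<subseteq> ?C - {w} - {u}" for X
    proof -
      have "finite X" using that finC finite_subset by blast
      moreover have "u \<notin> insert w X" using that u by auto
      ultimately have "(\<Sum>x\<in>insert u (insert w X). links J x w) =
          links J u w + (\<Sum>x\<in>insert w X. links J x w)" by (intro sum.insert) auto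
      then show ?thesis using u by (simp add: Q_def insert_commute)
    qed
    then show ?thesis using card_toggle[of "?C - {w}" u Q] finC u by simp
  next
    case False
    have "odd (links J w w)"
    proof -
      obtain u where u: "u \<in> W" "odd (links J u w)" using w by (auto simp: bad_def)
      then have "u \<notin> bad J" using w links_sym[of J u w] by (auto simp: bad_def)
      then show ?thesis using u False by auto
    qed
    have "Q X" if "X \<subseteq> ?C - {w}" for X
    proof -
      have "finite X" using that finC finite_subset by blast
      then have "(\<Sum>x\<in>insert w X. links J x w) = links J w w + (\<Sum>x\<in>X. links J x w)"
        using that by (intro sum.insert) auto
      moreover have "even (\<Sum>x\<in>X. links J x w)" using False that by (intro dvd_sum) auto
      ultimately show ?thesis using \<open>odd (links J w w)\<close> by (simp add: Q_def)
    qed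
    then have "{X. X \<subseteq> ?C - {w} \<and> Q X} = Pow (?C - {w})" by auto
    then show ?thesis using finC by (simp add: card_Pow)
  qed
  then show ?thesis using cL cC by simp
qed

lemma odds_toggle:
  assumes C: "C \<subseteq> W" and Y: "Y \<subseteq> W - C" and u: "u \<in> C" "(v, u) \<in> E"
  shows "2 * card {X. X \<subseteq> C \<and> odd (card (nbrs E v (X \<union> Y)))} = 2 ^ card C"
proof (rule card_toggle[OF finite_T[OF C] u(1)])
  fix X assume X: "X \<subseteq> C - {u}"
  have "finite (X \<union> Y)" using X Y C by (intro finite_T) auto
  moreover have "u \<notin> nbrs E v (X \<union> Y)" using X Y u by (auto simp: nbrs_def)
  ultimately show "odd (card (nbrs E v (insert u X \<union> Y))) \<longleftrightarrow> \<not> odd (card (nbrs E v (X \<union> Y)))"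
    using u by (simp add: nbrs_insert)
qed

text \<open>Average over \<open>X\<close> with \<open>Y\<close> fixed: a vertex of \<open>J\<close>
  with a good neighbour is odd half of the time, the others depend on \<open>Y\<close> alone, and a
  good vertex of \<open>W\<close> is right at least a quarter of the time. Multiplying by 4 gives
  the coefficients 2, 4 and 1.\<close>

lemma ex_average:
  assumes J: "J \<subseteq> I" and Y: "Y \<subseteq> bad J"
  shows "\<exists>X\<subseteq>W - bad J. 2 * card {v \<in> J. \<not> nbrs E v W \<subseteq> bad J} +
           4 * card {v \<in> J. nbrs E v W \<subseteq> bad J \<and> odd (card (nbrs E v Y))} + card (W - bad J)
           \<le> 4 * (card (odds J (X \<union> Y)) + card (right J (X \<union> Y)))"
proof -
  let ?C = "W - bad J"
  define J1 where "J1 = {v \<in> J. \<not> nbrs E v W \<subseteq> bad J}"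
  define J2 where "J2 = {v \<in> J. nbrs E v W \<subseteq> bad J \<and> odd (card (nbrs E v Y))}"
  have finC: "finite ?C" and finP: "finite (Pow ?C)" using finite_W by auto
  have finJ: "finite J" "finite J1" "finite J2" using finite_J[OF J] by (auto simp: J1_def J2_def)
  have odds_part: "card {v \<in> J1. odd (card (nbrs E v (X \<union> Y)))} + card J2 \<le> card (odds J (X \<union> Y))"
    if X: "X \<subseteq> ?C" for X
  proof -
    have "nbrs E v (X \<union> Y) = nbrs E v Y" if "v \<in> J2" for v
      using that X by (auto simp: J2_def nbrs_def)
    then have "J2 \<subseteq> odds J (X \<union> Y)" by (auto simp: odds_def J2_def)
    moreover have "{v \<in> J1. odd (card (nbrs E v (X \<union> Y)))} \<subseteq> odds J (X \<union> Y)"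
      by (auto simp: odds_def J1_def)
    moreover have "{v \<in> J1. odd (card (nbrs E v (X \<union> Y)))} \<inter> J2 = {}"
      by (auto simp: J1_def J2_def)
    moreover have "finite (odds J (X \<union> Y))" using finJ by (auto simp: odds_def)
    ultimately show ?thesis
      using finJ by (subst card_Un_disjoint[symmetric]) (auto intro!: card_mono)
  qed
  have right_part: "card {w \<in> ?C. w \<in> right J (X \<union> Y)} \<le> card (right J (X \<union> Y))" if "X \<subseteq> ?C" for X
  proof (rule card_mono)
    have "right J (X \<union> Y) \<subseteq> W" using that Y bad_subset by (auto simp: right_def)
    then show "finite (right J (X \<union> Y))" by (rule finite_T)
  qed auto
  have s1: "(\<Sum>X\<in>Pow ?C. 4 * card {v \<in> J1. odd (card (nbrs E v (X \<union> Y)))}) = 2 ^ card ?C * (2 * card J1)"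
  proof -
    have half: "2 * card {X \<in> Pow ?C. odd (card (nbrs E v (X \<union> Y)))} = 2 ^ card ?C"
      if v: "v \<in> J1" for v
    proof -
      obtain u where "u \<in> ?C" "(v, u) \<in> E" using v by (auto simp: J1_def nbrs_def)
      then show ?thesis using odds_toggle[of ?C Y u v] Y bad_subset by (auto simp: Pow_def)
    qed
    have "(\<Sum>X\<in>Pow ?C. 4 * card {v \<in> J1. odd (card (nbrs E v (X \<union> Y)))}) =
        2 * (\<Sum>v\<in>J1. 2 * card {X \<in> Pow ?C. odd (card (nbrs E v (X \<union> Y)))})"
      unfolding sum_distrib_left[symmetric] using finP finJ by (subst sum_card_swap) auto
    also have "\<dots> = 2 * (\<Sum>v\<in>J1. 2 ^ card ?C)"
      using half by (intro arg_cong[of _ _ "(*) 2"] sum.cong) auto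
    finally show ?thesis by simp
  qed
  have s2: "2 ^ card ?C * card ?C \<le> (\<Sum>X\<in>Pow ?C. 4 * card {w \<in> ?C. w \<in> right J (X \<union> Y)})"
  proof -
    have "(\<Sum>w\<in>?C. 2 ^ card ?C) \<le> (\<Sum>w\<in>?C. 4 * card {X \<in> Pow ?C. w \<in> right J (X \<union> Y)})"
      using card_right_toggle[OF J Y] by (intro sum_mono) (simp add: Pow_def)
    also have "\<dots> = (\<Sum>X\<in>Pow ?C. 4 * card {w \<in> ?C. w \<in> right J (X \<union> Y)})"
      unfolding sum_distrib_left[symmetric] using finP finC by (subst sum_card_swap) auto
    finally show ?thesis by (simp add: mult.commute)
  qed
  have "2 ^ card ?C * (2 * card J1 + 4 * card J2 + card ?C) \<le>
      (\<Sum>X\<in>Pow ?C. 4 * card {v \<in> J1. odd (card (nbrs E v (X \<union> Y)))}) + (\<Sum>X\<in>Pow ?C. 4 * card J2) +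
      (\<Sum>X\<in>Pow ?C. 4 * card {w \<in> ?C. w \<in> right J (X \<union> Y)})"
    using s1 s2 finC by (simp add: card_Pow algebra_simps)
  also have "\<dots> \<le> (\<Sum>X\<in>Pow ?C. 4 * (card (odds J (X \<union> Y)) + card (right J (X \<union> Y))))"
    unfolding sum.distrib[symmetric]
  proof (rule sum_mono)
    fix X assume "X \<in> Pow ?C"
    then show "4 * card {v \<in> J1. odd (card (nbrs E v (X \<union> Y)))} + 4 * card J2 +
        4 * card {w \<in> ?C. w \<in> right J (X \<union> Y)} \<le> 4 * (card (odds J (X \<union> Y)) + card (right J (X \<union> Y)))"
      using odds_part[of X] right_part[of X] by simp
  qed
  finally have "\<exists>X\<in>Pow ?C. 2 * card J1 + 4 * card J2 + card ?C \<le>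
      4 * (card (odds J (X \<union> Y)) + card (right J (X \<union> Y)))"
    using finC finP by (intro ex_ge_average) (auto simp: card_Pow)
  then show ?thesis by (auto simp: J1_def J2_def)
qed

text \<open>After \<open>ex_drop\<close>, \<open>odd_cut\<close> chooses the bad part
  \<open>Y\<close> of \<open>T\<close> and \<open>ex_average\<close> the good part
  \<open>X\<close>.\<close>

lemma ex_odd_set_linear:
  "\<exists>S\<subseteq>I \<union> W. (\<forall>v\<in>S. odd (card (nbrs E v S))) \<and> 6 * card I + card W \<le> 12 * card S"
proof -
  obtain R where R: "R \<subseteq> I - p ` W" "3 * card R + card (bad (I - R)) \<le> card W"
    and two: "\<And>v. v \<in> I - R \<Longrightarrow> card (nbrs E v (bad (I - R))) \<le> 2"
    using ex_drop by blast
  define J where "J = I - R"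
  \<comment> \<open>For these vertices only \<open>Y\<close> matters, and they have one or two
    neighbours in \<open>W\<close>, as \<open>odd_cut\<close> demands.\<close>
  define K where "K = {v \<in> J. nbrs E v W \<subseteq> bad J}"
  have J: "J \<subseteq> I" "p ` W \<subseteq> J" using R p_in_I by (auto simp: J_def)
  have fin: "finite J" "finite K" "finite (bad J)"
    using finite_J[OF J(1)] finite_T[OF bad_subset] by (auto simp: K_def)
  have K: "nbrs E v (bad J) = nbrs E v W" if "v \<in> K" for v
    using that bad_subset by (auto simp: K_def nbrs_def)
  have "\<exists>Y\<subseteq>bad J. 2 * card K + card (bad J) \<le> 4 * card {v \<in> K. odd (card (nbrs E v W \<inter> Y))}"
  proof (rule odd_cut)
    show "nbrs E v W \<subseteq> bad J \<and> nbrs E v W \<noteq> {} \<and> card (nbrs E v W) \<le> 2" if "v \<in> K" for v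
    proof -
      have "v \<in> I - R" using that by (auto simp: K_def J_def)
      moreover from this obtain w where "w \<in> W" "(v, w) \<in> E" using dominated by blast
      ultimately show ?thesis using that K[OF that] two[of v] by (auto simp: K_def J_def nbrs_def)
    qed
    show "\<exists>v\<in>K. nbrs E v W = {w}" if "w \<in> bad J" for w
    proof -
      have "w \<in> W" using that bad_subset by auto
      then have "nbrs E (p w) W = {w}" using p_private by (auto simp: nbrs_def)
      then show ?thesis using that J \<open>w \<in> W\<close> by (intro bexI[of _ "p w"]) (auto simp: K_def)
    qed
  qed (use fin in auto)
  then obtain Y where Y: "Y \<subseteq> bad J"
    and cut: "2 * card K + card (bad J) \<le> 4 * card {v \<in> K. odd (card (nbrs E v W \<inter> Y))}"
    by blast
  have "nbrs E v W \<inter> Y = nbrs E v Y" for v using Y bad_subset by (auto simp: nbrs_def)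
  then have K_odd: "{v \<in> K. odd (card (nbrs E v W \<inter> Y))} =
      {v \<in> J. nbrs E v W \<subseteq> bad J \<and> odd (card (nbrs E v Y))}" by (auto simp: K_def)
  obtain X where X: "X \<subseteq> W - bad J"
    and avg: "2 * card {v \<in> J. \<not> nbrs E v W \<subseteq> bad J} +
           4 * card {v \<in> J. nbrs E v W \<subseteq> bad J \<and> odd (card (nbrs E v Y))} + card (W - bad J)
           \<le> 4 * (card (odds J (X \<union> Y)) + card (right J (X \<union> Y)))"
    using ex_average[OF J(1) Y] by blast
  have JK: "{v \<in> J. \<not> nbrs E v W \<subseteq> bad J} = J - K" by (auto simp: K_def)
  have diff: "card (A - B) + card B = card A" if "finite A" "B \<subseteq> A" for A B :: "'a set"
    using that by (simp add: card_Diff_subset finite_subset card_mono)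
  have cK: "card (J - K) + card K = card J" using fin by (intro diff) (auto simp: K_def)
  have cB: "card (W - bad J) + card (bad J) = card W" using finite_W bad_subset by (intro diff)
  have cR: "card J + card R = card I" unfolding J_def using R finite_I by (intro diff) auto
  obtain S where S: "S \<subseteq> I \<union> W" "\<forall>v\<in>S. odd (card (nbrs E v S))"
    "card S = card (odds J (X \<union> Y)) + card (right J (X \<union> Y))"
    using ex_odd_set[OF _ J, of "X \<union> Y"] X Y bad_subset by blast
  have "6 * card I + card W \<le> 12 * card S"
  proof -
    \<comment> \<open>Averaging and the cut give \<open>4 * s \<ge> 2 * j + w\<close>, that is
      \<open>12 * s \<ge> 6 * j + 3 * w\<close>. Passing from \<open>j\<close> to \<open>i\<close>
      costs \<open>6 * r \<le> 2 * w\<close>, which leaves one \<open>w\<close>.\<close>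
    have "6 * i + w \<le> 12 * s"
      if "2 * jk + 4 * c + wb \<le> 4 * s" "2 * k + b \<le> 4 * c" "3 * r + b \<le> w" "jk + k = j"
        "wb + b = w" "j + r = i" for i w s jk c wb k b r j :: nat
      using that by linarith
    from this[OF avg[unfolded JK, folded S(3)] cut[unfolded K_odd] R(2)[folded J_def] cK cB cR]
    show ?thesis .
  qed
  with S show ?thesis by blast
qed

text \<open>A vertex of \<open>I\<close> is odd for half of all \<open>T\<close>, but
  \<open>T = {}\<close> yields no odd vertex, so the average over the other
  \<open>2 ^ card W - 1\<close> sets exceeds \<open>card I / 2\<close>.\<close>

lemma ex_odd_set_exponential:
  assumes "W \<noteq> {}"
  shows "\<exists>S\<subseteq>I \<union> W. (\<forall>v\<in>S. odd (card (nbrs E v S))) \<and>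
           card I * 2 ^ card W \<le> 2 * card S * (2 ^ card W - 1)"
proof -
  have finP: "finite (Pow W)" using finite_W by simp
  have "(\<Sum>T\<in>Pow W. 2 * card (odds I T)) = (\<Sum>v\<in>I. 2 * card {T \<in> Pow W. odd (card (nbrs E v T))})"
    unfolding sum_distrib_left[symmetric] odds_def using finP finite_I by (subst sum_card_swap) auto
  also have "\<dots> = (\<Sum>v\<in>I. 2 ^ card W)"
  proof (intro sum.cong refl)
    fix v assume "v \<in> I"
    then obtain w where "w \<in> W" "(v, w) \<in> E" using dominated by blast
    then show "2 * card {T \<in> Pow W. odd (card (nbrs E v T))} = 2 ^ card W"
      using odds_toggle[of W "{}" w v] by (simp add: Pow_def)
  qed
  finally have total: "(\<Sum>T\<in>Pow W. 2 * card (odds I T)) = card I * 2 ^ card W" by simp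
  have "odds I {} = {}" by (simp add: odds_def nbrs_def)
  then have total': "(\<Sum>T\<in>Pow W - {{}}. 2 * card (odds I T)) = card I * 2 ^ card W"
    using total finP by (subst (asm) sum.remove[of _ "{}"]) auto
  have card: "card (Pow W - {{}}) = 2 ^ card W - 1"
    using finite_W by (subst card_Diff_subset) (auto simp: card_Pow)
  have "\<exists>T\<in>Pow W - {{}}. card I * 2 ^ card W \<le> 2 * card (odds I T) * (2 ^ card W - 1)"
  proof (rule ex_ge_average)
    show "card (Pow W - {{}}) * (card I * 2 ^ card W)
        \<le> (\<Sum>T\<in>Pow W - {{}}. 2 * card (odds I T) * (2 ^ card W - 1))"
      unfolding sum_distrib_right[symmetric] total' card by simp
  qed (use finP assms in auto)
  then obtain T where T: "T \<subseteq> W" "card I * 2 ^ card W \<le> 2 * card (odds I T) * (2 ^ card W - 1)"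
    by auto
  obtain S where S: "S \<subseteq> I \<union> W" "\<forall>v\<in>S. odd (card (nbrs E v S))"
    "card S = card (odds I T) + card (right I T)"
    using ex_odd_set[OF T(1), of I] p_in_I by auto
  have "2 * card (odds I T) * (2 ^ card W - 1) \<le> 2 * card S * (2 ^ card W - 1)"
    using S by (intro mult_right_mono mult_left_mono) auto
  with T S show ?thesis by (meson order_trans)
qed

end

section \<open>The lower bound\<close>

lemma out_degree_induce_subgraph:
  assumes "v \<in> S"
  shows "out_degree (with_proj G \<restriction> S) v = card (nbrs (parcs G) v S)"
proof -
  have "out_arcs (with_proj G \<restriction> S) v = Pair v ` nbrs (parcs G) v S"
    using assms by (auto simp: nbrs_def)
  then show ?thesis by (simp add: out_degree_def card_image inj_on_def)
qed

lemma out_degree_with_proj: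
  assumes "pair_wf_digraph G"
  shows "out_degree (with_proj G) v = card (nbrs (parcs G) v (pverts G))"
proof -
  have "out_arcs (with_proj G) v = Pair v ` nbrs (parcs G) v (pverts G)"
    using pair_wf_digraph.in_arcsD2[OF assms] by (auto simp: nbrs_def)
  then show ?thesis by (simp add: out_degree_def card_image inj_on_def)
qed

lemma induces_odd_degrees_iff:
  "induces_odd_degrees G S \<longleftrightarrow> S \<subseteq> pverts G \<and> (\<forall>v\<in>S. odd (card (nbrs (parcs G) v S)))"
  by (auto simp: induces_odd_degrees_def out_degree_induce_subgraph)

lemma finite_induces_odd_degrees: "finite (pverts G) \<Longrightarrow> finite {S. induces_odd_degrees G S}"
  by (rule finite_subset[of _ "Pow (pverts G)"]) (auto simp: induces_odd_degrees_def)

lemma card_le_f_o: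
  assumes "finite (pverts G)" "induces_odd_degrees G S"
  shows "card S \<le> f_o G"
  unfolding f_o_def using assms by (intro Max_ge) (auto simp: finite_induces_odd_degrees)

lemma f_o_le:
  assumes "finite (pverts G)" "\<And>S. induces_odd_degrees G S \<Longrightarrow> card S \<le> m"
  shows "f_o G \<le> m"
proof -
  have "induces_odd_degrees G {}" by (simp add: induces_odd_degrees_def)
  then show ?thesis
    unfolding f_o_def using assms finite_induces_odd_degrees[of G] by (subst Max_le_iff) auto
qed

lemma finite_independent_vertices: "finite (pverts G) \<Longrightarrow> finite {S. independent_vertices G S}"
  by (rule finite_subset[of _ "Pow (pverts G)"]) (auto simp: independent_vertices_def)

lemma ex_maximum_independent:
  assumes "finite (pverts G)"
  obtains S where "independent_vertices G S" "card S = independence_number G"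
proof -
  have "independent_vertices G {}" by (simp add: independent_vertices_def)
  then have "independence_number G \<in> card ` {S. independent_vertices G S}"
    unfolding independence_number_def using assms
    by (intro Max_in) (auto simp: finite_independent_vertices)
  then show ?thesis using that by auto
qed

lemma independence_number_eqI:
  assumes "finite (pverts G)" "independent_vertices G I"
    and "\<And>S. independent_vertices G S \<Longrightarrow> card S \<le> card I"
  shows "independence_number G = card I"
  unfolding independence_number_def using assms
  by (intro Max_eqI) (auto simp: finite_independent_vertices)

lemma min_degree_ge_1_iff:
  assumes "finite (pverts G)" "pverts G \<noteq> {}" "pair_wf_digraph G"
  shows "1 \<le> min_degree G \<longleftrightarrow> (\<forall>v\<in>pverts G. \<exists>u\<in>pverts G. (v, u) \<in> parcs G)"
proof -
  have "1 \<le> card (nbrs (parcs G) v (pverts G)) \<longleftrightarrow> (\<exists>u\<in>pverts G. (v, u) \<in> parcs G)" for v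
    using assms(1) by (auto simp: Suc_le_eq card_gt_0_iff nbrs_def)
  then show ?thesis
    unfolding min_degree_def using assms by (subst Min_ge_iff) (auto simp: out_degree_with_proj)
qed

text \<open>In a minimal dominating set outside \<open>I\<close>, removing \<open>w\<close> leaves
  some vertex of \<open>I\<close> without a neighbour; that vertex is \<open>p w\<close>.\<close>

lemma ex_private_domination:
  assumes "pair_graph G" and I: "independent_vertices G I"
    and nonisolated: "\<And>v. v \<in> I \<Longrightarrow> \<exists>u\<in>pverts G. (v, u) \<in> parcs G"
  obtains W p where "W \<subseteq> pverts G" "private_domination (parcs G) I W p"
proof -
  interpret pair_graph G by fact
  define \<W> where "\<W> = {W. W \<subseteq> pverts G - I \<and> (\<forall>v\<in>I. \<exists>w\<in>W. (v, w) \<in> parcs G)}"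
  have "finite \<W>"
    by (rule finite_subset[of _ "Pow (pverts G)"]) (use pair_finite_verts in \<open>auto simp: \<W>_def\<close>)
  moreover have "pverts G - I \<in> \<W>"
    using nonisolated I by (fastforce simp: \<W>_def independent_vertices_def)
  ultimately obtain W where W: "W \<in> \<W>" and min: "\<And>W'. W' \<in> \<W> \<Longrightarrow> W' \<subseteq> W \<Longrightarrow> W' = W"
    using finite_has_minimal2[of \<W> "pverts G - I"] by metis
  have "\<exists>v\<in>I. \<forall>u\<in>W. (v, u) \<in> parcs G \<longleftrightarrow> u = w" if w: "w \<in> W" for w
  proof -
    have "W - {w} \<notin> \<W>" using min[of "W - {w}"] w by auto
    then obtain v where v: "v \<in> I" "\<forall>u\<in>W - {w}. (v, u) \<notin> parcs G"
      using W by (auto simp: \<W>_def)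
    moreover obtain u where "u \<in> W" "(v, u) \<in> parcs G" using W v by (auto simp: \<W>_def)
    ultimately have "\<forall>u\<in>W. (v, u) \<in> parcs G \<longleftrightarrow> u = w" by blast
    with v show ?thesis by blast
  qed
  then obtain p where p: "\<And>w. w \<in> W \<Longrightarrow> p w \<in> I \<and> (\<forall>u\<in>W. (p w, u) \<in> parcs G \<longleftrightarrow> u = w)"
    by metis
  have "private_domination (parcs G) I W p"
  proof
    show "finite I" "finite W"
      using I W pair_finite_verts by (auto simp: independent_vertices_def \<W>_def dest: finite_subset)
    show "(v, u) \<in> parcs G" if "(u, v) \<in> parcs G" for u v
      using that pair_sym_arcs by (auto simp: symmetric_def dest: symD)
    show "(u, u) \<notin> parcs G" for u using pair_no_loops by fastforce
  qed (use I W p in \<open>auto simp: independent_vertices_def \<W>_def\<close>)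
  moreover have "W \<subseteq> pverts G" using W by (auto simp: \<W>_def)
  ultimately show ?thesis using that by blast
qed

text \<open>Both bounds hold for the same \<open>k\<close>, the size of a dominating set;
  \<open>additive_term_bound\<close> plays them against each other.\<close>

lemma f_o_lower_bounds:
  assumes G: "pair_graph G" and deg: "min_degree G \<ge> 1" and pos: "independence_number G \<ge> 1"
  obtains k where "6 * independence_number G + k \<le> 12 * f_o G"
    "independence_number G * 2 ^ k \<le> 2 * f_o G * (2 ^ k - 1)"
proof -
  interpret pair_graph G by fact
  note fin = pair_finite_verts
  obtain I where I: "independent_vertices G I" "card I = independence_number G"
    using ex_maximum_independent[OF fin] .
  then have "I \<noteq> {}" and IV: "I \<subseteq> pverts G" using pos by (auto simp: independent_vertices_def)
  then have "\<exists>u\<in>pverts G. (v, u) \<in> parcs G" if "v \<in> I" for v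
    using deg that min_degree_ge_1_iff[OF fin] pair_wf_digraph_axioms by blast
  then obtain W p where W: "W \<subseteq> pverts G" and dom: "private_domination (parcs G) I W p"
    using ex_private_domination[OF G I(1)] by blast
  interpret private_domination "parcs G" I W p by fact
  have "W \<noteq> {}" using dominated \<open>I \<noteq> {}\<close> by blast
  have f_o: "card S \<le> f_o G" if "S \<subseteq> I \<union> W" "\<forall>v\<in>S. odd (card (nbrs (parcs G) v S))" for S
    using that IV W fin by (intro card_le_f_o) (auto simp: induces_odd_degrees_iff)
  show ?thesis
  proof
    show "6 * independence_number G + card W \<le> 12 * f_o G"
      using ex_odd_set_linear f_o I(2) by fastforce
    obtain S where S: "S \<subseteq> I \<union> W" "\<forall>v\<in>S. odd (card (nbrs (parcs G) v S))"
      "card I * 2 ^ card W \<le> 2 * card S * (2 ^ card W - 1)"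
      using ex_odd_set_exponential[OF \<open>W \<noteq> {}\<close>] by blast
    have "2 * card S * (2 ^ card W - 1) \<le> 2 * f_o G * (2 ^ card W - 1)"
      using f_o[OF S(1,2)] by (intro mult_right_mono mult_left_mono) auto
    with S(3) show "independence_number G * 2 ^ card W \<le> 2 * f_o G * (2 ^ card W - 1)"
      unfolding I(2) by linarith
  qed
qed

section \<open>Numerical estimates for the additive term\<close>

lemma additive_term_eq:
  assumes "a > 0"
  shows "additive_term a = (log 3 (real a) / 2 - log 3 (log 3 (real a) / 2)) / 4"
  using assms by (simp add: additive_term_def log_def ln_sqrt mult.commute)

lemma log_3_9: "log 3 (9 :: real) = 2"
  using log_nat_power[of 3 3 2] by simp

text \<open>In this range \<open>K \<le> 1\<close> and \<open>log 3 K \<ge> - 1\<close>, which gives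
  \<open>(1 + 1) / 4\<close>. A half is what integrality provides in
  \<open>additive_term_bound\<close>.\<close>

lemma additive_term_le_half:
  assumes "3 \<le> a" "a \<le> 9"
  shows "additive_term a \<le> 1 / 2"
proof -
  define K where "K = log 3 (real a) / 2"
  have "log 3 3 \<le> log 3 (real a)" using assms by (subst log_le_cancel_iff) auto
  then have "1 / 2 \<le> K" by (simp add: K_def)
  have "log 3 (real a) \<le> log 3 9" using assms by (subst log_le_cancel_iff) auto
  then have "K \<le> 1" by (simp add: K_def log_3_9)
  have "log 3 (1 / 3) \<le> log 3 K" using \<open>1 / 2 \<le> K\<close> by (subst log_le_cancel_iff) auto
  then have "- 1 \<le> log 3 K" by (simp add: log_divide)
  with \<open>K \<le> 1\<close> show ?thesis using assms by (simp add: additive_term_eq K_def[symmetric])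
qed

text \<open>For \<open>a = 2\<close> integrality gives \<open>f \<ge> 2\<close>, a whole unit above
  \<open>a / 2\<close>, so \<open>K \<ge> 1 / 9\<close> is precise enough.\<close>

lemma additive_term_2: "additive_term 2 \<le> 1"
proof -
  define K where "K = log 3 2 / (2 :: real)"
  have "log 3 9 \<le> log 3 (2 ^ 9 :: real)" by (subst log_le_cancel_iff) auto
  also have "\<dots> = 9 * log 3 2" by (subst log_nat_power) auto
  finally have "1 / 9 \<le> K" by (simp add: K_def log_3_9)
  have "log 3 2 \<le> log 3 (9 :: real)" by (subst log_le_cancel_iff) auto
  then have "K \<le> 1" by (simp add: K_def log_3_9)
  have "log 3 (1 / 9) \<le> log 3 K" using \<open>1 / 9 \<le> K\<close> by (subst log_le_cancel_iff) auto
  then have "- 2 \<le> log 3 K" by (simp add: log_divide log_3_9)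
  with \<open>K \<le> 1\<close> show ?thesis by (simp add: additive_term_eq K_def[symmetric])
qed

text \<open>
  With \<open>K = log 3 a / 2\<close> and \<open>L = log 3 K\<close> the additive term is \<open>(K - L) / 4\<close>. If \<open>k < 3 (K - L)\<close>
  then \<open>2 ^ k < 8 powr (K - L)\<close>, whereas \<open>a = 9 powr K\<close>.
\<close>

lemma additive_term_bound:
  fixes a f k :: nat
  assumes a: "2 \<le> a" and lin: "6 * a + k \<le> 12 * f" and ex: "a * 2 ^ k \<le> 2 * f * (2 ^ k - 1)"
  shows "real a / 2 + additive_term a \<le> real f"
proof (cases "a \<le> 9")
  case True
  \<comment> \<open>For small \<open>a\<close> the exponential bound is used only to obtain the
    strict inequality \<open>a < 2 * f\<close> between integers.\<close>
  have "a * (2 ^ k - 1) < a * 2 ^ k" using a by simp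
  with ex have "a * (2 ^ k - 1) < 2 * f * (2 ^ k - 1)" by linarith
  then have f: "a < 2 * f" by simp
  show ?thesis
  proof (cases "a = 2")
    case True
    then show ?thesis using f additive_term_2 by simp
  next
    case False
    then have "additive_term a \<le> 1 / 2" using a \<open>a \<le> 9\<close> by (intro additive_term_le_half) auto
    moreover have "real a + 1 \<le> 2 * real f" using f by linarith
    ultimately show ?thesis by simp
  qed
next
  case False
  define K where "K = log 3 (real a) / 2"
  define L where "L = log 3 K"
  have add: "additive_term a = (K - L) / 4" using a by (simp add: additive_term_eq K_def L_def)
  have "log 3 9 \<le> log 3 (real a)" using False by (subst log_le_cancel_iff) auto
  then have K: "1 \<le> K" by (simp add: K_def log_3_9)
  then have L: "0 \<le> L" by (simp add: L_def)
  show ?thesis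
  \<comment> \<open>At this value of \<open>k\<close> the linear bound \<open>a / 2 + k / 12\<close>
    reaches \<open>a / 2 + (K - L) / 4\<close>.\<close>
  proof (cases "3 * (K - L) \<le> real k")
    case True
    have "6 * real a + real k \<le> 12 * real f" using lin by linarith
    with True show ?thesis unfolding add by argo
  next
    case False
    have "2 ^ k = (2 :: real) powr real k" by (simp add: powr_realpow)
    also have "\<dots> \<le> 2 powr (3 * (K - L))" using False by (intro powr_mono) auto
    also have "\<dots> = (2 powr 3) powr (K - L)" by (simp only: powr_powr)
    also have "\<dots> = 8 powr (K - L)" by simp
    finally have k: "2 ^ k \<le> (8 :: real) powr (K - L)" .
    \<comment> \<open>Since \<open>K = 3 powr L \<le> 8 powr L\<close>, the factor \<open>K\<close>
      is absorbed: \<open>K * 2 ^ k \<le> 8 powr K \<le> 9 powr K = a\<close>.\<close>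
    have "K = 3 powr L" using K by (simp add: L_def)
    also have "\<dots> \<le> 8 powr L" using L by (intro powr_mono2) auto
    finally have "K * 8 powr (K - L) \<le> 8 powr L * 8 powr (K - L)" by (intro mult_right_mono) auto
    also have "\<dots> = 8 powr K" by (simp add: powr_add[symmetric])
    also have "\<dots> \<le> 9 powr K" using K by (intro powr_mono2) auto
    also have "9 powr K = (3 powr 2) powr K" by simp
    also have "\<dots> = real a" using a unfolding powr_powr by (simp add: K_def)
    finally have Ka: "K * 2 ^ k \<le> real a"
      using k K by (meson dual_order.trans mult_left_mono order_trans zero_le_one)
    have "real (a * 2 ^ k) \<le> real (2 * f * (2 ^ k - 1))" using ex by (rule of_nat_mono)
    then have "real a * 2 ^ k \<le> 2 * real f * (2 ^ k - 1)" by simp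
    then have gain: "real a * 2 ^ k + 2 * real f \<le> 2 * real f * 2 ^ k" by (simp add: algebra_simps)
    then have "real a * 2 ^ k \<le> 2 * real f * 2 ^ k" using of_nat_0_le_iff[of f] by linarith
    then have "real a \<le> 2 * real f" by simp
    \<comment> \<open>The summand \<open>2 * f\<close> in \<open>gain\<close> is at least
      \<open>a \<ge> K * 2 ^ k\<close>, so \<open>2 * f \<ge> a + K\<close>; the surplus
      \<open>K / 2\<close> exceeds \<open>(K - L) / 4\<close>.\<close>
    with gain Ka have "(real a + K) * 2 ^ k \<le> 2 * real f * 2 ^ k" by (simp add: distrib_right)
    then have "real a + K \<le> 2 * real f" by simp
    with K L show ?thesis unfolding add by argo
  qed
qed

section \<open>Graphs with small odd induced subgraphs\<close>

text \<open>Vertex \<open>i < d\<close> is a coordinate and vertex \<open>d + j\<close> stands for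
  the set \<open>\<phi> j\<close>. Indexing by \<open>j\<close> admits repeated sets.\<close>

definition code_graph :: "nat \<Rightarrow> nat \<Rightarrow> (nat \<Rightarrow> nat set) \<Rightarrow> nat pair_pre_digraph" where
  "code_graph d a \<phi> = \<lparr>pverts = {..<d + a},
     parcs = {(u, v). u < d \<and> v \<in> {d..<d + a} \<and> u \<in> \<phi> (v - d) \<or>
                      v < d \<and> u \<in> {d..<d + a} \<and> v \<in> \<phi> (u - d)}\<rparr>"

lemma code_graph_simps [simp]:
  "pverts (code_graph d a \<phi>) = {..<d + a}"
  "(u, v) \<in> parcs (code_graph d a \<phi>) \<longleftrightarrow>
     u < d \<and> v \<in> {d..<d + a} \<and> u \<in> \<phi> (v - d) \<or> v < d \<and> u \<in> {d..<d + a} \<and> v \<in> \<phi> (u - d)"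
  by (simp_all add: code_graph_def)

lemma pair_graph_code_graph: "pair_graph (code_graph d a \<phi>)"
proof
  let ?G = "code_graph d a \<phi>"
  show "fst e \<in> pverts ?G" "snd e \<in> pverts ?G" if "e \<in> parcs ?G" for e
    using that by (cases e; auto)+
  show "finite (pverts ?G)" by simp
  show "finite (parcs ?G)"
    by (rule finite_subset[of _ "{..<d + a} \<times> {..<d + a}"]) auto
  show "symmetric ?G" by (auto simp: symmetric_def intro!: symI)
  show "fst e \<noteq> snd e" if "e \<in> parcs ?G" for e using that by (cases e) auto
qed

lemma bipartite_code_graph: "bipartite (code_graph d a \<phi>)"
  unfolding bipartite_def by (intro exI[of _ "{..<d}"] exI[of _ "{d..<d + a}"]) auto

locale code =
  fixes d a :: nat and \<phi> :: "nat \<Rightarrow> nat set"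
  assumes nonempty: "j < a \<Longrightarrow> \<phi> j \<noteq> {}"
    and subset: "j < a \<Longrightarrow> \<phi> j \<subseteq> {..<d}"
    and unit: "i < d \<Longrightarrow> \<exists>j<a. \<phi> j = {i}"
begin

lemma min_degree_code_graph:
  assumes "a \<ge> 1"
  shows "min_degree (code_graph d a \<phi>) \<ge> 1"
proof -
  have "\<exists>u<d + a. (v, u) \<in> parcs (code_graph d a \<phi>)" if v: "v < d + a" for v
  proof (cases "v < d")
    case True
    then obtain j where "j < a" "\<phi> j = {v}" using unit by blast
    then show ?thesis using True by (intro exI[of _ "d + j"]) auto
  next
    case False
    then have j: "v - d < a" using v by auto
    then obtain i where "i \<in> \<phi> (v - d)" using nonempty by blast
    moreover from this have "i < d" using subset[OF j] by auto
    ultimately show ?thesis using False v by (intro exI[of _ i]) auto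
  qed
  moreover have "pair_wf_digraph (code_graph d a \<phi>)"
    using pair_graph_code_graph by (simp add: pair_graph_def pair_digraph_def pair_fin_digraph_def)
  moreover have "{..<d + a} \<noteq> {}" using assms by auto
  ultimately show ?thesis
    by (subst min_degree_ge_1_iff) (simp_all add: Bex_def del: code_graph_simps(2))
qed

text \<open>Each \<open>i < d\<close> is adjacent to the vertex \<open>d + m i\<close> of its unit
  set; replacing \<open>i\<close> by this partner maps an independent set injectively into
  \<open>{d..<d + a}\<close>.\<close>

lemma independence_number_code_graph: "independence_number (code_graph d a \<phi>) = a"
proof -
  obtain m where m: "\<And>i. i < d \<Longrightarrow> m i < a \<and> \<phi> (m i) = {i}" using unit by metis
  define h where "h v = (if v < d then d + m v else v)" for v
  have "card S \<le> card {d..<d + a}" if S: "independent_vertices (code_graph d a \<phi>) S" for S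
  proof (rule card_inj_on_le[of h])
    have V: "v < d + a" if "v \<in> S" for v
      using S that by (auto simp: independent_vertices_def)
    have cross: "u \<noteq> d + m v" if "u \<in> S" "v \<in> S" "v < d" for u v
    proof
      assume "u = d + m v"
      then have "(v, u) \<in> parcs (code_graph d a \<phi>)" using m[of v] that by simp
      then show False using S that unfolding independent_vertices_def by blast
    qed
    show "inj_on h S"
    proof (rule inj_onI)
      fix u v assume uv: "u \<in> S" "v \<in> S" "h u = h v"
      show "u = v"
      proof (cases "u < d"; cases "v < d")
        assume "u < d" "v < d"
        then have "m u = m v" using uv by (simp add: h_def)
        then have "{u} = {v}" using m[OF \<open>u < d\<close>] m[OF \<open>v < d\<close>] by metis
        then show ?thesis by simp
      next
        assume "u < d" "\<not> v < d"
        then show ?thesis using uv cross[of v u] by (simp add: h_def)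
      next
        assume "\<not> u < d" "v < d"
        then show ?thesis using uv cross[of u v] by (simp add: h_def)
      next
        assume "\<not> u < d" "\<not> v < d"
        then show ?thesis using uv by (simp add: h_def)
      qed
    qed
    show "h ` S \<subseteq> {d..<d + a}"
    proof
      fix x assume "x \<in> h ` S"
      then obtain v where v: "v \<in> S" "x = h v" by blast
      then show "x \<in> {d..<d + a}" using V[of v] m[of v] by (cases "v < d") (auto simp: h_def)
    qed
  qed simp
  moreover have "independent_vertices (code_graph d a \<phi>) {d..<d + a}"
    by (auto simp: independent_vertices_def)
  ultimately show ?thesis
    using independence_number_eqI[of "code_graph d a \<phi>" "{d..<d + a}"] by simp
qed

text \<open>A vertex \<open>d + j\<close> of \<open>S\<close> has degree
  \<open>card (\<phi> j \<inter> T)\<close> for \<open>T = S \<inter> {..<d}\<close>; the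
  coordinates in \<open>S\<close> number at most \<open>d\<close>.\<close>

lemma f_o_code_graph:
  assumes "\<And>T. T \<subseteq> {..<d} \<Longrightarrow> card {j. j < a \<and> odd (card (\<phi> j \<inter> T))} \<le> m"
  shows "f_o (code_graph d a \<phi>) \<le> d + m"
proof (rule f_o_le)
  fix S assume S: "induces_odd_degrees (code_graph d a \<phi>) S"
  define T where "T = S \<inter> {..<d}"
  have sub: "S \<subseteq> {..<d + a}" and odd: "\<And>v. v \<in> S \<Longrightarrow> odd (card (nbrs (parcs (code_graph d a \<phi>)) v S))"
    using S by (auto simp: induces_odd_degrees_iff)
  have "S \<subseteq> {..<d} \<union> (+) d ` {j. j < a \<and> odd (card (\<phi> j \<inter> T))}"
  proof
    fix v assume v: "v \<in> S"
    show "v \<in> {..<d} \<union> (+) d ` {j. j < a \<and> odd (card (\<phi> j \<inter> T))}"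
    proof (cases "v < d")
      case False
      then have "v = d + (v - d)" "v - d < a" using v sub by auto
      moreover have "nbrs (parcs (code_graph d a \<phi>)) v S = \<phi> (v - d) \<inter> T"
        using False v sub subset[OF \<open>v - d < a\<close>] by (auto simp: nbrs_def T_def)
      ultimately show ?thesis using odd[OF v] by auto
    qed simp
  qed
  then have "card S \<le> card ({..<d} \<union> (+) d ` {j. j < a \<and> odd (card (\<phi> j \<inter> T))})"
    by (intro card_mono) auto
  also have "\<dots> \<le> card {..<d} + card ((+) d ` {j. j < a \<and> odd (card (\<phi> j \<inter> T))})"
    by (rule card_Un_le)
  also have "card ((+) d ` {j. j < a \<and> odd (card (\<phi> j \<inter> T))}) \<le> m"
    using assms[of T] by (subst card_image) (auto simp: T_def)
  finally show "card S \<le> d + m" by simp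
qed simp

end

text \<open>Equivalently, the sets with odd intersection outnumber the others by at most
  \<open>c\<close>. The bound is one-sided, as suits an upper bound on \<open>f_o\<close>.\<close>

definition discrepancy_le :: "nat \<Rightarrow> nat \<Rightarrow> (nat \<Rightarrow> nat set) \<Rightarrow> nat \<Rightarrow> bool" where
  "discrepancy_le d a \<phi> c \<longleftrightarrow>
     (\<forall>T\<subseteq>{..<d}. 2 * card {j. j < a \<and> odd (card (\<phi> j \<inter> T))} \<le> a + c)"

text \<open>Toggling an element of \<open>T\<close> shows that half of all \<open>2 ^ d\<close>
  subsets meet it oddly; the missing empty set never does, and its absence is the excess 1.\<close>

lemma ex_cube_code:
  "\<exists>\<phi>. code d (2 ^ d - 1) \<phi> \<and> discrepancy_le d (2 ^ d - 1) \<phi> 1"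
proof -
  have card: "card (Pow {..<d} - {{}}) = 2 ^ d - 1"
    by (subst card_Diff_subset) (auto simp: card_Pow)
  obtain \<phi> where \<phi>: "bij_betw \<phi> {0..<2 ^ d - 1 :: nat} (Pow {..<d} - {{}})"
    using ex_bij_betw_nat_finite[of "Pow {..<d} - {{}}"] card by auto
  have mem: "\<phi> j \<in> Pow {..<d} - {{}}" if "j < 2 ^ d - 1" for j
    using bij_betwE[OF \<phi>] that by auto
  have "code d (2 ^ d - 1) \<phi>"
  proof
    show "\<exists>j<2 ^ d - 1. \<phi> j = {i}" if "i < d" for i
    proof -
      have "{i} \<in> \<phi> ` {0..<2 ^ d - 1}" using bij_betw_imp_surj_on[OF \<phi>] that by simp
      then show ?thesis by (metis atLeastLessThan_iff imageE)
    qed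
  qed (use mem in auto)
  moreover have "discrepancy_le d (2 ^ d - 1) \<phi> 1"
    unfolding discrepancy_le_def
  proof (intro allI impI)
    fix T assume T: "T \<subseteq> {..<d}"
    have "inj_on \<phi> {j. j < 2 ^ d - 1 \<and> odd (card (\<phi> j \<inter> T))}"
      by (rule inj_on_subset[OF bij_betw_imp_inj_on[OF \<phi>]]) auto
    then have "card {j. j < 2 ^ d - 1 \<and> odd (card (\<phi> j \<inter> T))} =
        card (\<phi> ` {j. j < 2 ^ d - 1 \<and> odd (card (\<phi> j \<inter> T))})" by (simp add: card_image)
    also have "\<dots> \<le> card {X. X \<subseteq> {..<d} \<and> odd (card (X \<inter> T))}"
      using mem by (intro card_mono) auto
    finally have "2 * card {j. j < 2 ^ d - 1 \<and> odd (card (\<phi> j \<inter> T))} \<le>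
        2 * card {X. X \<subseteq> {..<d} \<and> odd (card (X \<inter> T))}" by simp
    also have "\<dots> \<le> 2 ^ d"
    proof (cases "T = {}")
      case False
      then obtain u where u: "u \<in> T" by blast
      have "2 * card {X. X \<subseteq> {..<d} \<and> odd (card (X \<inter> T))} = 2 ^ card {..<d}"
      proof (rule card_toggle)
        fix X assume "X \<subseteq> {..<d} - {u}"
        then have "finite X" "u \<notin> X" using finite_subset by auto
        then show "odd (card (insert u X \<inter> T)) \<longleftrightarrow> \<not> odd (card (X \<inter> T))" using u by simp
      qed (use u T in auto)
      then show ?thesis by simp
    qed simp
    finally show "2 * card {j. j < 2 ^ d - 1 \<and> odd (card (\<phi> j \<inter> T))} \<le> 2 ^ d - 1 + 1" by simp
  qed
  ultimately show ?thesis by blast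
qed

lemma discrepancy_le_append:
  assumes "discrepancy_le d a \<phi> c" "discrepancy_le d b \<psi> c'"
  shows "discrepancy_le d (a + b) (\<lambda>j. if j < a then \<phi> j else \<psi> (j - a)) (c + c')"
  unfolding discrepancy_le_def
proof (intro allI impI)
  fix T assume T: "T \<subseteq> {..<d}"
  let ?A = "{j. j < a \<and> odd (card (\<phi> j \<inter> T))}" and ?B = "{j. j < b \<and> odd (card (\<psi> j \<inter> T))}"
  have "{j. j < a + b \<and> odd (card ((if j < a then \<phi> j else \<psi> (j - a)) \<inter> T))} \<subseteq> ?A \<union> (+) a ` ?B"
    (is "?L \<subseteq> _")
  proof
    fix j assume j: "j \<in> ?L"
    show "j \<in> ?A \<union> (+) a ` ?B"
    proof (cases "j < a")
      case False
      then have "j = a + (j - a)" "j - a \<in> ?B" using j by auto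
      then show ?thesis by blast
    qed (use j in auto)
  qed
  then have "card ?L \<le> card (?A \<union> (+) a ` ?B)" by (intro card_mono) auto
  also have "\<dots> \<le> card ?A + card ((+) a ` ?B)" by (rule card_Un_le)
  also have "card ((+) a ` ?B) = card ?B" by (rule card_image) simp
  finally have "card ?L \<le> card ?A + card ?B" .
  moreover have "2 * card ?A \<le> a + c" "2 * card ?B \<le> b + c'"
    using assms T by (auto simp: discrepancy_le_def)
  ultimately show "2 * card ?L \<le> a + b + (c + c')" by linarith
qed

lemma code_append:
  assumes "code d a \<phi>" "\<And>j. j < b \<Longrightarrow> \<psi> j \<noteq> {} \<and> \<psi> j \<subseteq> {..<d}"
  shows "code d (a + b) (\<lambda>j. if j < a then \<phi> j else \<psi> (j - a))"
proof
  show "\<exists>j<a + b. (if j < a then \<phi> j else \<psi> (j - a)) = {i}" if "i < d" for i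
  proof -
    obtain j where "j < a" "\<phi> j = {i}" using code.unit[OF assms(1)] \<open>i < d\<close> by blast
    then show ?thesis by (intro exI[of _ j]) auto
  qed
  show "(if j < a then \<phi> j else \<psi> (j - a)) \<noteq> {}" if "j < a + b" for j
    using that assms(2)[of "j - a"] code.nonempty[OF assms(1), of j] by auto
  show "(if j < a then \<phi> j else \<psi> (j - a)) \<subseteq> {..<d}" if "j < a + b" for j
    using that assms(2)[of "j - a"] code.subset[OF assms(1), of j] by (cases "j < a") auto
qed

text \<open>Sets inside \<open>{..<d}\<close> see only \<open>T \<inter> {..<d}\<close>, so families
  from a smaller dimension can be reused.\<close>

lemma discrepancy_le_mono_dim:
  assumes "discrepancy_le d a \<phi> c" "\<And>j. j < a \<Longrightarrow> \<phi> j \<subseteq> {..<d}" "c \<le> c'"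
  shows "discrepancy_le d' a \<phi> c'"
  unfolding discrepancy_le_def
proof (intro allI impI)
  fix T :: "nat set"
  have "\<phi> j \<inter> T = \<phi> j \<inter> (T \<inter> {..<d})" if "j < a" for j using assms(2)[OF that] by auto
  then have "{j. j < a \<and> odd (card (\<phi> j \<inter> T))} = {j. j < a \<and> odd (card (\<phi> j \<inter> (T \<inter> {..<d})))}"
    by (metis (mono_tags, lifting))
  moreover have "2 * card {j. j < a \<and> odd (card (\<phi> j \<inter> (T \<inter> {..<d})))} \<le> a + c"
    using assms(1) by (simp add: discrepancy_le_def)
  ultimately show "2 * card {j. j < a \<and> odd (card (\<phi> j \<inter> T))} \<le> a + c'"
    using assms(3) by simp
qed

text \<open>Full cubes are split off greedily, at most one in each step of the induction and each
  with excess 1.\<close>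

lemma ex_balanced:
  "a < 2 ^ d \<Longrightarrow> \<exists>\<phi>. (\<forall>j<a. \<phi> j \<noteq> {} \<and> \<phi> j \<subseteq> {..<d}) \<and> discrepancy_le d a \<phi> d"
proof (induction d arbitrary: a)
  case 0
  then show ?case by (auto simp: discrepancy_le_def)
next
  case (Suc d)
  \<comment> \<open>The value \<open>2 ^ Suc d - 1\<close> is separate: splitting off
    \<open>2 ^ d - 1\<close> would leave \<open>2 ^ d\<close> sets, one too many for the induction
    hypothesis.\<close>
  consider "a < 2 ^ d" | "2 ^ d \<le> a" "a < 2 ^ Suc d - 1" | "a = 2 ^ Suc d - 1" using Suc.prems by linarith
  then show ?case
  proof cases
    case 1
    then obtain \<phi> where \<phi>: "\<forall>j<a. \<phi> j \<noteq> {} \<and> \<phi> j \<subseteq> {..<d}" "discrepancy_le d a \<phi> d"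
      using Suc.IH by blast
    then have "discrepancy_le (Suc d) a \<phi> (Suc d)"
      using discrepancy_le_mono_dim[of d a \<phi> d] by simp
    moreover have "\<phi> j \<noteq> {} \<and> \<phi> j \<subseteq> {..<Suc d}" if "j < a" for j
      using \<phi>(1) that by fastforce
    ultimately show ?thesis by blast
  next
    case 2
    let ?b = "a - (2 ^ d - 1)"
    have "?b < 2 ^ d" using 2 by simp
    then obtain \<psi> where \<psi>: "\<forall>j<?b. \<psi> j \<noteq> {} \<and> \<psi> j \<subseteq> {..<d}" "discrepancy_le d ?b \<psi> d"
      using Suc.IH by blast
    obtain \<phi> where \<phi>: "code d (2 ^ d - 1) \<phi>" "discrepancy_le d (2 ^ d - 1) \<phi> 1"
      using ex_cube_code by blast
    define \<chi> where "\<chi> j = (if j < 2 ^ d - 1 then \<phi> j else \<psi> (j - (2 ^ d - 1)))" for j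
    have a: "2 ^ d - 1 + ?b = a" using 2 by simp
    have "code d a \<chi>" using code_append[OF \<phi>(1), of ?b \<psi>] \<psi>(1) unfolding \<chi>_def a by blast
    then have \<chi>: "\<chi> j \<noteq> {} \<and> \<chi> j \<subseteq> {..<d}" if "j < a" for j
      using that code.nonempty code.subset by metis
    have "discrepancy_le d a \<chi> (Suc d)"
      using discrepancy_le_append[OF \<phi>(2) \<psi>(2)] unfolding \<chi>_def a by simp
    then have "discrepancy_le (Suc d) a \<chi> (Suc d)"
      using \<chi> discrepancy_le_mono_dim by blast
    moreover have "\<chi> j \<noteq> {} \<and> \<chi> j \<subseteq> {..<Suc d}" if "j < a" for j using \<chi>[OF that] by fastforce
    ultimately show ?thesis by blast
  next
    case 3
    obtain \<phi> where \<phi>: "code (Suc d) a \<phi>" "discrepancy_le (Suc d) a \<phi> 1"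
      using ex_cube_code[of "Suc d"] 3 by blast
    then have "discrepancy_le (Suc d) a \<phi> (Suc d)"
      by (intro discrepancy_le_mono_dim[OF \<phi>(2)]) (auto dest: code.subset)
    then show ?thesis using code.nonempty[OF \<phi>(1)] code.subset[OF \<phi>(1)] by blast
  qed
qed

text \<open>For the largest \<open>d\<close> with \<open>2 ^ d \<le> a + 1\<close>, the full cube
  supplies all unit sets and fewer than \<open>2 ^ d\<close> sets remain for
  \<open>ex_balanced\<close>; the excesses are 1 and \<open>d\<close>.\<close>

lemma ex_code:
  assumes "1 \<le> a"
  obtains d \<phi> where "code d a \<phi>" "discrepancy_le d a \<phi> (d + 1)" "2 ^ d \<le> a + 1"
proof -
  have "\<exists>d. 2 ^ d \<le> a + 1 \<and> a + 1 < 2 ^ (d + 1)" by (rule ex_power_ivl1) auto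
  then obtain d where d: "2 ^ d \<le> a + 1" "a + 1 < 2 ^ (d + 1)" by blast
  let ?b = "a - (2 ^ d - 1)"
  have "?b < 2 ^ d" using d by simp
  then obtain \<psi> where \<psi>: "\<forall>j<?b. \<psi> j \<noteq> {} \<and> \<psi> j \<subseteq> {..<d}" "discrepancy_le d ?b \<psi> d"
    using ex_balanced[OF \<open>?b < 2 ^ d\<close>] by blast
  obtain \<phi> where \<phi>: "code d (2 ^ d - 1) \<phi>" "discrepancy_le d (2 ^ d - 1) \<phi> 1"
    using ex_cube_code by blast
  have a: "2 ^ d - 1 + ?b = a" using d by simp
  show ?thesis
  proof (rule that)
    show "code d a (\<lambda>j. if j < 2 ^ d - 1 then \<phi> j else \<psi> (j - (2 ^ d - 1)))"
      using code_append[OF \<phi>(1), of ?b \<psi>] \<psi>(1) unfolding a by blast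
    show "discrepancy_le d a (\<lambda>j. if j < 2 ^ d - 1 then \<phi> j else \<psi> (j - (2 ^ d - 1))) (d + 1)"
      using discrepancy_le_append[OF \<phi>(2) \<psi>(2)] unfolding a by (simp add: add.commute)
  qed (rule d(1))
qed

lemma code_graph_witness:
  assumes "1 \<le> a" "code d a \<phi>" "discrepancy_le d a \<phi> c"
  defines "G \<equiv> code_graph d a \<phi>"
  shows "min_degree G \<ge> 1" "independence_number G = a" "2 * f_o G \<le> 2 * d + a + c"
proof -
  interpret code d a \<phi> by fact
  show "min_degree G \<ge> 1" "independence_number G = a"
    using assms(1) min_degree_code_graph independence_number_code_graph by (auto simp: G_def)
  have "f_o G \<le> d + (a + c) div 2"
    unfolding G_def using assms(3) by (intro f_o_code_graph) (auto simp: discrepancy_le_def less_eq_div_iff_mult_less_eq)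
  then show "2 * f_o G \<le> 2 * d + a + c" by simp
qed

section \<open>The order of the additive term\<close>

lemma f_o_lower_bound:
  assumes "pair_graph G" "min_degree G \<ge> 1" "independence_number G \<ge> 2"
  shows "real (independence_number G) / 2 + additive_term (independence_number G) \<le> real (f_o G)"
proof -
  have "1 \<le> independence_number G" using assms(3) by simp
  then show ?thesis
    using f_o_lower_bounds[OF assms(1,2)] additive_term_bound[OF assms(3)] by metis
qed

text \<open>The factor 3 collects \<open>2 * d\<close> from the coordinates and \<open>d\<close>
  from the excess in the bound on \<open>2 * f_o G\<close>.\<close>

lemma ex_graph_f_o_le:
  assumes "1 \<le> a"
  obtains G :: "nat pair_pre_digraph" where "pair_graph G" "min_degree G \<ge> 1"
    "independence_number G = a" "real (f_o G) \<le> real a / 2 + (3 * log 2 (real a + 1) + 1) / 2"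
proof -
  obtain d \<phi> where code: "code d a \<phi>" "discrepancy_le d a \<phi> (d + 1)" and d: "2 ^ d \<le> a + 1"
    using ex_code[OF assms] .
  note wit = code_graph_witness[OF assms code]
  have "real (2 ^ d) \<le> real (a + 1)" using d by (rule of_nat_mono)
  then have "real d \<le> log 2 (real a + 1)" by (subst le_log_iff) (auto simp: powr_realpow add.commute)
  moreover have "real (2 * f_o (code_graph d a \<phi>)) \<le> real (2 * d + a + (d + 1))"
    using wit(3) by (rule of_nat_mono)
  then have "2 * real (f_o (code_graph d a \<phi>)) \<le> 1 + (3 * real d + real a)" by simp
  ultimately have "real (f_o (code_graph d a \<phi>)) \<le> real a / 2 + (3 * log 2 (real a + 1) + 1) / 2"
    by argo
  with wit(1,2) pair_graph_code_graph show ?thesis using that by blast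
qed

lemma additive_term_le_best:
  assumes "2 \<le> a"
  shows "additive_term a \<le> best_additive_term a"
  unfolding best_additive_term_def
proof (rule cINF_greatest)
  have "1 \<le> a" using assms by simp
  then show "{G :: nat pair_pre_digraph. pair_graph G \<and> min_degree G \<ge> 1 \<and> independence_number G = a} \<noteq> {}"
    using ex_graph_f_o_le[of a] by blast
qed (use f_o_lower_bound assms in fastforce)

lemma best_additive_term_le:
  assumes "1 \<le> a"
  shows "best_additive_term a \<le> (3 * log 2 (real a + 1) + 1) / 2"
proof -
  let ?A = "{G :: nat pair_pre_digraph. pair_graph G \<and> min_degree G \<ge> 1 \<and> independence_number G = a}"
  obtain G :: "nat pair_pre_digraph" where G: "G \<in> ?A"
    and f_o: "real (f_o G) \<le> real a / 2 + (3 * log 2 (real a + 1) + 1) / 2"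
    using ex_graph_f_o_le[OF assms] by blast
  \<comment> \<open>Since \<open>f_o G \<ge> 0\<close>, the set is bounded below, so its infimum is
    at most each of its elements.\<close>
  have "bdd_below ((\<lambda>G. real (f_o G) - real a / 2) ` ?A)"
    by (intro bdd_belowI2[of _ "- real a / 2"]) simp
  then have "best_additive_term a \<le> real (f_o G) - real a / 2"
    unfolding best_additive_term_def using G by (rule cINF_lower)
  with f_o show ?thesis by linarith
qed

text \<open>Eventually \<open>0 \<le> additive_term a \<le> best_additive_term a\<close>, and the
  latter is at most of logarithmic order. The additive term has that order too, as its iterated
  logarithm is negligible.\<close>

lemma additive_term_bigtheta: "additive_term \<in> \<Theta>(best_additive_term)"
proof -
  have nonneg: "eventually (\<lambda>a. 0 \<le> additive_term a) sequentially"
    unfolding additive_term_def by real_asymp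
  have "additive_term \<in> O(best_additive_term)"
  proof (rule bigoI[of _ 1])
    show "eventually (\<lambda>a. norm (additive_term a) \<le> 1 * norm (best_additive_term a)) sequentially"
      using nonneg eventually_ge_at_top[of 2]
      by eventually_elim (use additive_term_le_best in fastforce)
  qed
  moreover have "best_additive_term \<in> O(additive_term)"
  proof (rule landau_o.big_trans)
    show "best_additive_term \<in> O(\<lambda>a. (3 * log 2 (real a + 1) + 1) / 2)"
    proof (rule bigoI[of _ 1])
      show "eventually (\<lambda>a. norm (best_additive_term a) \<le> 1 * norm ((3 * log 2 (real a + 1) + 1) / 2))
          sequentially"
        using nonneg eventually_ge_at_top[of 2]
      proof eventually_elim
        case (elim a)
        then have "0 \<le> best_additive_term a" using additive_term_le_best[of a] by linarith
        then show ?case using best_additive_term_le[of a] elim by simp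
      qed
    qed
    show "(\<lambda>a. (3 * log 2 (real a + 1) + 1) / 2) \<in> O(additive_term)"
      unfolding additive_term_def by real_asymp
  qed
  ultimately show ?thesis by (simp add: bigtheta_def bigomega_iff_bigo)
qed

theorem proposition29:
  shows "(\<forall>d::nat. d \<ge> 1 \<longrightarrow>
           (\<exists>G :: nat pair_pre_digraph. pair_graph G \<and> bipartite G \<and> min_degree G \<ge> 1 \<and>
              independence_number G = 2 ^ d - 1 \<and>
              real (f_o G) \<le> real (independence_number G) / 2
                              + log 2 (real (independence_number G) + 1) + 1 / 2))
       \<and> (\<forall>G :: 'a pair_pre_digraph.
            pair_graph G \<and> min_degree G \<ge> 1 \<and> independence_number G \<ge> 2 \<longrightarrow>
              real (f_o G) \<ge> real (independence_number G) / 2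
                              + additive_term (independence_number G))
       \<and> additive_term \<in> \<Theta>(best_additive_term)"
proof (intro conjI allI impI)
  fix d :: nat assume "d \<ge> 1"
  then have "(2 :: nat) \<le> 2 ^ d" by (metis power_increasing one_le_numeral power_one_right)
  then have pos: "1 \<le> (2 :: nat) ^ d - 1" by simp
  obtain \<phi> where code: "code d (2 ^ d - 1) \<phi>" "discrepancy_le d (2 ^ d - 1) \<phi> 1"
    using ex_cube_code by blast
  define G where "G = code_graph d (2 ^ d - 1) \<phi>"
  note wit = code_graph_witness[OF pos code, folded G_def]
  \<comment> \<open>The full cube has excess 1, and for \<open>a = 2 ^ d - 1\<close> the dimension
    \<open>d\<close> is exactly \<open>log 2 (a + 1)\<close>.\<close>
  have "real (2 * f_o G) \<le> real (2 * d + (2 ^ d - 1) + 1)" using wit(3) by (rule of_nat_mono)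
  then have "2 * real (f_o G) \<le> 2 * real d + 2 ^ d" by simp
  then have "real (f_o G) \<le> (2 ^ d - 1) / 2 + real d + 1 / 2" by argo
  moreover have "log 2 (2 ^ d) = real d" by (subst log_nat_power) auto
  ultimately have "real (f_o G) \<le> real (independence_number G) / 2
      + log 2 (real (independence_number G) + 1) + 1 / 2"
    unfolding wit(2) by simp
  with wit(1,2) show "\<exists>G :: nat pair_pre_digraph. pair_graph G \<and> bipartite G \<and> min_degree G \<ge> 1 \<and>
      independence_number G = 2 ^ d - 1 \<and>
      real (f_o G) \<le> real (independence_number G) / 2
                      + log 2 (real (independence_number G) + 1) + 1 / 2"
    using pair_graph_code_graph bipartite_code_graph unfolding G_def by blast
next
  show "real (independence_number G) / 2 + additive_term (independence_number G) \<le> real (f_o G)"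
    if "pair_graph G \<and> min_degree G \<ge> 1 \<and> independence_number G \<ge> 2" for G :: "'a pair_pre_digraph"
    using that f_o_lower_bound by blast
qed (rule additive_term_bigtheta)

end
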